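(* Let $R$ be a graded ring such that $R_0$ is a field of characteristic $p$, where $p$ is a prime. Then $R$ is a polynomial ring if and only if there exist an $F$-factorization $(\phi,\sigma)$ on $R$ and a set $\mathcal{D}$ of Hasse derivations on $R$ that is admissible with respect to $(\phi,\sigma)$.
   Context: Rings are commutative with unit; graded means graded by the non-negative integers. A graded ring $R$ with $R_0$ a field is a polynomial ring if there is a (possibly infinite) set of homogeneous elements of positive degree that is algebraically independent over $R_0$ and generates $R$ as an $R_0$-algebra. For a ring $R$ of characteristic $p$, $F_R\colon R\to R$ denotes $x\mapsto x^p$ and $R^p$ its image. An $F$-factorization on a graded ring $R$ of characteristic $p$ is a pair $(\phi,\sigma)$ such that: (F1) $\phi\colon R\to R$ is an injective homomorphism of graded rings with $\phi|_{R_0}=F_{R_0}$; (F2) $\sigma\colon R\to R$ is a ring homomorphism with $\sigma|_{R_0}=\mathrm{id}_{R_0}$; (F3) $\phi$ and $\sigma$ commute and $\phi\circ\sigma=F_R$; (F4) for any $\epsilon_1,\ldots,\epsilon_s\in R_0$ we have $\mathrm{im}(\sigma)\cap\sum_{j=1}^s\epsilon_j\,\mathrm{im}(\phi)=\sum_{j=1}^s\epsilon_j R^p$. A Hasse derivation on a ring $R$ is a collection $\partial=\{\partial^n\}_{n\in\mathbf{N}}$ (with $0\in\mathbf{N}$) of additive endomorphisms of $R$ with $\partial^0=\mathrm{id}$ and $\partial^n(xy)=\sum_{i+j=n}\partial^i(x)\partial^j(y)$ for all $x,y\in R$. If $R$ has characteristic $p$, write $\partial^{[r]}=\partial^{p^r}$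 (so $\partial^{[0]}=\partial^1$). On a graded ring, $\partial$ is homogeneous of degree $d$ if for every homogeneous $x$ the element $\partial^n(x)$ is homogeneous of degree $\deg(x)+nd$ (hence zero if this is negative). Given a graded ring $R$ with $R_0$ a field of characteristic $p$ and an $F$-factorization $(\phi,\sigma)$, a set $\mathcal{D}$ of Hasse derivations on $R$ is admissible with respect to $(\phi,\sigma)$ if: (D1) each $\partial\in\mathcal{D}$ is homogeneous of negative degree; (D2) each $\partial\in\mathcal{D}$ commutes with $\phi$ (i.e. every $\partial^n$ does); (D3) if $x\in R$ is homogeneous, $\epsilon_1,\ldots,\epsilon_s\in R_0$ ($s=0$ allowed), and $\partial^{[0]}(x)\in\sum_{j=1}^s\epsilon_j\,\mathrm{im}(\phi)$ for all $\partial\in\mathcal{D}$, then $x\in\mathrm{im}(\sigma)+\sum_{j=1}^s\epsilon_j\,\mathrm{im}(\phi)$. *)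

theory Defs
  imports
    "HOL-Library.Poly_Mapping"
    "HOL-Computational_Algebra.Computational_Algebra"
begin

section \<open>Graded rings\<close>

text \<open>The ring is given by a type of class \<open>comm_ring_1\<close>, and \<open>G n\<close> is its degree \<open>n\<close> part. Note that
  \<open>comm_ring_1\<close> includes \<open>0 \<noteq> 1\<close>, which is harmless here since \<open>G 0\<close> will be a field.\<close>

definition is_subring :: "'a::comm_ring_1 set \<Rightarrow> bool" where
  "is_subring S \<longleftrightarrow> 1 \<in> S \<and> (\<forall>x\<in>S. \<forall>y\<in>S. x - y \<in> S \<and> x * y \<in> S)"

definition is_subfield :: "'a::comm_ring_1 set \<Rightarrow> bool" where
  "is_subfield K \<longleftrightarrow> is_subring K \<and> (\<forall>a\<in>K. a \<noteq> 0 \<longrightarrow> (\<exists>b\<in>K. a * b = 1))"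

locale graded_ring =
  fixes G :: "nat \<Rightarrow> 'a::comm_ring_1 set"
  assumes zero_mem: "0 \<in> G n"
    and diff_mem: "x \<in> G n \<Longrightarrow> y \<in> G n \<Longrightarrow> x - y \<in> G n"
    and one_mem: "1 \<in> G 0"
    and mult_mem: "x \<in> G m \<Longrightarrow> y \<in> G n \<Longrightarrow> x * y \<in> G (m + n)"
    and direct_sum: "\<exists>!c. (\<forall>n. c n \<in> G n) \<and> finite {n. c n \<noteq> 0} \<and> x = (\<Sum>n | c n \<noteq> 0. c n)"

definition homogeneous :: "(nat \<Rightarrow> 'a::comm_ring_1 set) \<Rightarrow> 'a \<Rightarrow> bool" where
  "homogeneous G x \<longleftrightarrow> (\<exists>n. x \<in> G n)"

section \<open>Polynomial rings\<close>

text \<open>A polynomial in a set \<open>X\<close> of ring elements is a finitely supported map from monomials to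
  coefficients, where a monomial is a finitely supported exponent function. The variables are indexed
  by the elements of \<open>X\<close> themselves, and \<open>poly_value\<close> substitutes each element for its variable.\<close>

definition polys_over :: "'a::comm_ring_1 set \<Rightarrow> 'a set \<Rightarrow> (('a \<Rightarrow>\<^sub>0 nat) \<Rightarrow>\<^sub>0 'a) set" where
  "polys_over K X =
     {P. (\<forall>m. Poly_Mapping.lookup P m \<in> K) \<and>
         (\<forall>m\<in>Poly_Mapping.keys P. Poly_Mapping.keys m \<subseteq> X)}"

definition poly_value :: "(('a::comm_ring_1 \<Rightarrow>\<^sub>0 nat) \<Rightarrow>\<^sub>0 'a) \<Rightarrow> 'a" where
  "poly_value P =
     (\<Sum>m\<in>Poly_Mapping.keys P.
        Poly_Mapping.lookup P m * (\<Prod>x\<in>Poly_Mapping.keys m. x ^ Poly_Mapping.lookup m x))"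

definition algebraically_independent :: "'a::comm_ring_1 set \<Rightarrow> 'a set \<Rightarrow> bool" where
  "algebraically_independent K X \<longleftrightarrow> (\<forall>P\<in>polys_over K X. poly_value P = 0 \<longrightarrow> P = 0)"

definition generates_algebra :: "'a::comm_ring_1 set \<Rightarrow> 'a set \<Rightarrow> bool" where
  "generates_algebra K X \<longleftrightarrow> is_subring hull (K \<union> X) = UNIV"

text \<open>In \<open>is_polynomial_ring\<close>, \<open>G 0\<close> is understood to be a field. Although \<open>0\<close> lies in every
  \<open>G n\<close>, it cannot belong to \<open>X\<close> because of the algebraic independence.\<close>

definition is_polynomial_ring :: "(nat \<Rightarrow> 'a::comm_ring_1 set) \<Rightarrow> bool" where
  "is_polynomial_ring G \<longleftrightarrow>
     (\<exists>X. (\<forall>x\<in>X. \<exists>n>0. x \<in> G n) \<and> algebraically_independent (G 0) X \<and>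
          generates_algebra (G 0) X)"

section \<open>\<open>F\<close>-factorizations\<close>

definition is_ring_hom :: "('a::comm_ring_1 \<Rightarrow> 'b::comm_ring_1) \<Rightarrow> bool" where
  "is_ring_hom f \<longleftrightarrow>
     f 1 = 1 \<and> (\<forall>x y. f (x + y) = f x + f y) \<and> (\<forall>x y. f (x * y) = f x * f y)"

text \<open>\<open>lin_span es S\<close> is \<open>\<epsilon>\<^sub>1 S + \<dots> + \<epsilon>\<^sub>s S\<close>; it is \<open>{0}\<close> for \<open>s = 0\<close>.\<close>

definition lin_span :: "'a::comm_ring_1 list \<Rightarrow> 'a set \<Rightarrow> 'a set" where
  "lin_span es S = {\<Sum>j<length es. es ! j * y j | y. \<forall>j<length es. y j \<in> S}"

text \<open>A homomorphism of graded rings preserves degrees, whereas \<open>\<sigma>\<close> is only a ring homomorphism.\<close>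

definition F_factorization ::
  "nat \<Rightarrow> (nat \<Rightarrow> 'a::comm_ring_1 set) \<Rightarrow> ('a \<Rightarrow> 'a) \<Rightarrow> ('a \<Rightarrow> 'a) \<Rightarrow> bool" where
  "F_factorization p G \<phi> \<sigma> \<longleftrightarrow>
     is_ring_hom \<phi> \<and> inj \<phi> \<and> (\<forall>n. \<phi> ` G n \<subseteq> G n) \<and> (\<forall>a\<in>G 0. \<phi> a = a ^ p) \<and>
     is_ring_hom \<sigma> \<and> (\<forall>a\<in>G 0. \<sigma> a = a) \<and>
     \<phi> \<circ> \<sigma> = \<sigma> \<circ> \<phi> \<and> \<phi> \<circ> \<sigma> = (\<lambda>x. x ^ p) \<and>
     (\<forall>es. set es \<subseteq> G 0 \<longrightarrow>
        range \<sigma> \<inter> lin_span es (range \<phi>) = lin_span es (range (\<lambda>x. x ^ p)))"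

section \<open>Hasse derivations\<close>

definition hasse_derivation :: "(nat \<Rightarrow> 'a::comm_ring_1 \<Rightarrow> 'a) \<Rightarrow> bool" where
  "hasse_derivation \<delta> \<longleftrightarrow>
     (\<forall>n. additive (\<delta> n)) \<and> \<delta> 0 = id \<and>
     (\<forall>n x y. \<delta> n (x * y) = (\<Sum>i\<le>n. \<delta> i x * \<delta> (n - i) y))"

text \<open>The degree \<open>d\<close> is not unique in general: if all \<open>\<delta> n\<close> with \<open>n > 0\<close> vanish, every \<open>d\<close> will do.\<close>

definition hasse_homogeneous ::
  "(nat \<Rightarrow> 'a::comm_ring_1 set) \<Rightarrow> int \<Rightarrow> (nat \<Rightarrow> 'a \<Rightarrow> 'a) \<Rightarrow> bool" where
  "hasse_homogeneous G d \<delta> \<longleftrightarrow>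
     (\<forall>k. \<forall>x\<in>G k. \<forall>n.
        let e = int k + int n * d in if e < 0 then \<delta> n x = 0 else \<delta> n x \<in> G (nat e))"

text \<open>\<open>hasse_bracket p \<delta> r\<close> is \<open>\<partial>\<^bsup>[r]\<^esup>\<close>, where \<open>\<delta>\<close> stands for \<open>\<partial>\<close>.\<close>

definition hasse_bracket :: "nat \<Rightarrow> (nat \<Rightarrow> 'a \<Rightarrow> 'a) \<Rightarrow> nat \<Rightarrow> 'a \<Rightarrow> 'a" where
  "hasse_bracket p \<delta> r = \<delta> (p ^ r)"

definition admissible ::
  "nat \<Rightarrow> (nat \<Rightarrow> 'a::comm_ring_1 set) \<Rightarrow> ('a \<Rightarrow> 'a) \<Rightarrow> ('a \<Rightarrow> 'a) \<Rightarrow>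
   (nat \<Rightarrow> 'a \<Rightarrow> 'a) set \<Rightarrow> bool" where
  "admissible p G \<phi> \<sigma> \<D> \<longleftrightarrow>
     (\<forall>\<delta>\<in>\<D>. hasse_derivation \<delta>) \<and>
     (\<forall>\<delta>\<in>\<D>. \<exists>d<0. hasse_homogeneous G d \<delta>) \<and>
     (\<forall>\<delta>\<in>\<D>. \<forall>n. \<delta> n \<circ> \<phi> = \<phi> \<circ> \<delta> n) \<and>
     (\<forall>x es. homogeneous G x \<longrightarrow> set es \<subseteq> G 0 \<longrightarrow>
        (\<forall>\<delta>\<in>\<D>. hasse_bracket p \<delta> 0 x \<in> lin_span es (range \<phi>)) \<longrightarrow>
        x \<in> {a + b | a b. a \<in> range \<sigma> \<and> b \<in> lin_span es (range \<phi>)})"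

end

theory Submission
  imports Defs
begin

text \<open>
  Suppose first that the ring is a polynomial ring in homogeneous variables \<open>X\<close> over the field
  \<open>K = G 0\<close>. Let \<open>\<phi>\<close> be Frobenius on \<open>K\<close> and the identity on variables, let \<open>\<sigma>\<close> be the identity on
  \<open>K\<close> and \<open>x \<mapsto> x\<^sup>p\<close> on variables, and let \<open>\<D>\<close> consist of the divided power derivatives with respect to
  the variables. The image of \<open>\<phi>\<close> consists of the polynomials whose coefficients are \<open>p\<close>-th powers, and
  the image of \<open>\<sigma>\<close> of those whose exponents are divisible by \<open>p\<close>, so the remaining conditions can be
  checked one coefficient at a time (\<open>range_\<phi>_iff\<close>, \<open>range_\<sigma>_iff\<close>, \<open>coeff_in_lin_span\<close>).

  Conversely, let \<open>(\<phi>, \<sigma>)\<close> and \<open>\<D>\<close> be given. From \<open>\<phi> \<circ> \<sigma> = F\<close> and the commutation of \<open>\<delta>\<close> with \<open>\<phi>\<close> one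
  gets \<open>\<delta>\<^bsub>p m\<^esub> \<circ> \<sigma> = \<sigma> \<circ> \<delta>\<^sub>m\<close>. An element killed by all first derivatives lies in the image of \<open>\<sigma>\<close>,
  so descending along \<open>\<sigma>\<close> shows that only elements of \<open>K\<close> are killed by all \<open>\<delta>\<^sub>m\<close> with \<open>m > 0\<close>
  (\<open>constants\<close>). This is the property that drives the rest.

  Let \<open>X\<close> be a homogeneous lift of a basis of the positive part modulo decomposables. It generates, and a
  nonzero relation \<open>f\<close> of least degree between its elements is excluded in two steps.

  Lift the derivations to the polynomial ring over \<open>K\<close> on \<open>X\<close>. They lower degrees, so by minimality they
  kill \<open>f\<close> not only in the ring but as a polynomial. Hence one may differentiate again, now formally
  with respect to the variables. By the chain rule the partial derivative of \<open>f\<close> with respect to a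
  variable of top weight is killed by all derivations (\<open>relation_top_derivative\<close>), so it is a constant.
  A nonzero constant would be a linear term of \<open>f\<close>, contradicting the choice of \<open>X\<close>. So all partial
  derivatives of \<open>f\<close> vanish, and \<open>f\<close> is a polynomial in the \<open>p\<close>-th powers of the variables.

  Over a perfect field \<open>f\<close> would now be a \<open>p\<close>-th power. In general, the fact about constants
  implies that \<open>K\<close> is linearly disjoint from the \<open>p\<close>-th powers of the ring in the sense of
  \<open>p_linear_disjoint\<close>, and this turns \<open>f\<close> into a nonzero relation of degree \<open>deg(f) / p\<close>, contradicting
  minimality.
\<close>

section \<open>Evaluation of polynomials\<close>

abbreviation lookup :: "('v \<Rightarrow>\<^sub>0 'c::zero) \<Rightarrow> 'v \<Rightarrow> 'c" where "lookup \<equiv> Poly_Mapping.lookup"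
abbreviation keys :: "('v \<Rightarrow>\<^sub>0 'c::zero) \<Rightarrow> 'v set" where "keys \<equiv> Poly_Mapping.keys"
abbreviation single :: "'v \<Rightarrow> 'c \<Rightarrow> 'v \<Rightarrow>\<^sub>0 'c::zero" where "single \<equiv> Poly_Mapping.single"

abbreviation Const :: "'c \<Rightarrow> ('v \<Rightarrow>\<^sub>0 nat) \<Rightarrow>\<^sub>0 'c::zero" where "Const c \<equiv> single 0 c"
abbreviation Var :: "'v \<Rightarrow> ('v \<Rightarrow>\<^sub>0 nat) \<Rightarrow>\<^sub>0 'c::zero_neq_one" where "Var x \<equiv> single (single x (Suc 0)) 1"

lemma is_ring_homI:
  assumes "f 1 = 1" "\<And>x y. f (x + y) = f x + f y" "\<And>x y. f (x * y) = f x * f y"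
  shows "is_ring_hom f"
  using assms by (simp add: is_ring_hom_def)

context
  fixes f :: "'a::comm_ring_1 \<Rightarrow> 'b::comm_ring_1"
  assumes f: "is_ring_hom f"
begin

lemma ring_hom_1: "f 1 = 1" using f by (simp add: is_ring_hom_def)
lemma ring_hom_add: "f (x + y) = f x + f y" using f by (simp add: is_ring_hom_def)
lemma ring_hom_mult: "f (x * y) = f x * f y" using f by (simp add: is_ring_hom_def)
lemma ring_hom_0: "f 0 = 0" using ring_hom_add[of 0 0] by simp
lemma ring_hom_diff: "f (x - y) = f x - f y" using ring_hom_add[of "x - y" y] by simp
lemma ring_hom_sum: "f (sum g A) = (\<Sum>i\<in>A. f (g i))"
  by (induction A rule: infinite_finite_induct) (auto simp: ring_hom_0 ring_hom_add)
lemma ring_hom_prod: "f (prod g A) = (\<Prod>i\<in>A. f (g i))"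
  by (induction A rule: infinite_finite_induct) (auto simp: ring_hom_1 ring_hom_mult)
lemma ring_hom_power: "f (x ^ n) = f x ^ n"
  by (induction n) (auto simp: ring_hom_1 ring_hom_mult)

end

lemma ring_hom_id: "is_ring_hom (\<lambda>x. x)"
  by (simp add: is_ring_hom_def)

lemma ring_hom_comp: "is_ring_hom f \<Longrightarrow> is_ring_hom g \<Longrightarrow> is_ring_hom (\<lambda>x. f (g x))"
  by (simp add: is_ring_hom_def)

lemma ring_hom_Const: "is_ring_hom (Const :: 'c::comm_ring_1 \<Rightarrow> ('v \<Rightarrow>\<^sub>0 nat) \<Rightarrow>\<^sub>0 'c)"
  by (simp add: is_ring_hom_def Poly_Mapping.single_add Poly_Mapping.mult_single)

lemma ring_hom_fps_const: "is_ring_hom (fps_const :: 'b::comm_ring_1 \<Rightarrow> 'b fps)"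
  by (simp add: is_ring_hom_def)

definition map_fps :: "('a \<Rightarrow> 'b) \<Rightarrow> 'a fps \<Rightarrow> 'b fps" where
  "map_fps f F = Abs_fps (\<lambda>n. f (fps_nth F n))"

lemma map_fps_nth [simp]: "fps_nth (map_fps f F) n = f (fps_nth F n)"
  by (simp add: map_fps_def)

lemma ring_hom_map_fps: "is_ring_hom f \<Longrightarrow> is_ring_hom (map_fps f)"
  by (rule is_ring_homI)
     (auto simp: fps_eq_iff fps_mult_nth ring_hom_1 ring_hom_0 ring_hom_add ring_hom_mult ring_hom_sum)

text \<open>The coefficient map \<open>c\<close> is separate from the values \<open>v\<close> of the variables, so that Frobenius can
act on coefficients alone, and so that the target can be a power series ring: this is how Hasse
derivations are prescribed on variables.\<close>

definition monom_value :: "('v \<Rightarrow> 'b::comm_ring_1) \<Rightarrow> ('v \<Rightarrow>\<^sub>0 nat) \<Rightarrow> 'b" where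
  "monom_value v m = (\<Prod>x\<in>keys m. v x ^ lookup m x)"

definition subst ::
  "('c::comm_ring_1 \<Rightarrow> 'b::comm_ring_1) \<Rightarrow> ('v \<Rightarrow> 'b) \<Rightarrow> (('v \<Rightarrow>\<^sub>0 nat) \<Rightarrow>\<^sub>0 'c) \<Rightarrow> 'b" where
  "subst c v P = (\<Sum>m\<in>keys P. c (lookup P m) * monom_value v m)"

lemma poly_value_conv_subst: "poly_value = subst (\<lambda>c. c) (\<lambda>x. x)"
  by (simp add: fun_eq_iff poly_value_def subst_def monom_value_def)

lemma monom_value_superset:
  assumes "finite A" "keys m \<subseteq> A"
  shows "monom_value v m = (\<Prod>x\<in>A. v x ^ lookup m x)"
  unfolding monom_value_def using assms
  by (intro prod.mono_neutral_left) (auto simp: in_keys_iff)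

lemma monom_value_0 [simp]: "monom_value v 0 = 1"
  by (simp add: monom_value_def)

lemma monom_value_single [simp]: "monom_value v (single x n) = v x ^ n"
  by (simp add: monom_value_def)

lemma monom_value_add: "monom_value v (m + m') = monom_value v m * monom_value v m'"
proof -
  have A: "finite (keys m \<union> keys m')" by simp
  show ?thesis
    using keys_add[of m m']
    by (simp add: monom_value_superset[OF A] lookup_add power_add prod.distrib)
qed

lemma monom_value_hom:
  assumes "is_ring_hom h"
  shows "h (monom_value v m) = monom_value (\<lambda>x. h (v x)) m"
  by (simp add: monom_value_def ring_hom_prod[OF assms] ring_hom_power[OF assms])

lemma monom_value_cong:
  "(\<And>x. x \<in> keys m \<Longrightarrow> v x = w x) \<Longrightarrow> monom_value v m = monom_value w m"
  by (simp add: monom_value_def)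

lemma monom_value_Var: "monom_value Var m = single m 1"
proof -
  have pow: "(Var x :: ('a \<Rightarrow>\<^sub>0 nat) \<Rightarrow>\<^sub>0 'b) ^ n = single (single x n) 1" for x n
    by (induction n) (simp_all add: Poly_Mapping.mult_single flip: Poly_Mapping.single_add)
  have prd: "(\<Prod>x\<in>A. single (g x) (1::'b)) = single (sum g A) 1"
    for g :: "'a \<Rightarrow> 'a \<Rightarrow>\<^sub>0 nat" and A
    by (induction A rule: infinite_finite_induct) (simp_all add: Poly_Mapping.mult_single)
  have "(\<Sum>x\<in>keys m. single x (lookup m x)) = m"
    by (intro poly_mapping_eqI) (auto simp: lookup_sum lookup_single when_def in_keys_iff)
  then show ?thesis
    unfolding monom_value_def pow prd by simp
qed

lemma poly_expand: "P = (\<Sum>m\<in>keys P. single m (lookup P m))"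
  by (intro poly_mapping_eqI) (auto simp: lookup_sum lookup_single when_def in_keys_iff)

lemma subst_superset:
  assumes "c 0 = 0" "finite A" "keys P \<subseteq> A"
  shows "subst c v P = (\<Sum>m\<in>A. c (lookup P m) * monom_value v m)"
  unfolding subst_def using assms
  by (intro sum.mono_neutral_left) (auto simp: in_keys_iff)

lemma subst_0 [simp]: "subst c v 0 = 0"
  by (simp add: subst_def)

lemma subst_single: "c 0 = 0 \<Longrightarrow> subst c v (single m a) = c a * monom_value v m"
  by (simp add: subst_def)

lemma subst_add:
  assumes "is_ring_hom c"
  shows "subst c v (P + Q) = subst c v P + subst c v Q"
proof -
  have A: "finite (keys P \<union> keys Q)" by simp
  show ?thesis
    using keys_add[of P Q]
    by (simp add: subst_superset[where c = c, OF ring_hom_0[OF assms] A] lookup_add ring_hom_add[OF assms]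
        distrib_right sum.distrib)
qed

lemma subst_sum:
  assumes "is_ring_hom c"
  shows "subst c v (sum f A) = (\<Sum>i\<in>A. subst c v (f i))"
  by (induction A rule: infinite_finite_induct) (auto simp: subst_add[OF assms])

lemma subst_mult:
  assumes c: "is_ring_hom c"
  shows "subst c v (P * Q) = subst c v P * subst c v Q"
proof -
  note [simp] = subst_single[where c = c, OF ring_hom_0[OF c]]
  have "P * Q = (\<Sum>m\<in>keys P. \<Sum>n\<in>keys Q. single (m + n) (lookup P m * lookup Q n))"
    by (subst poly_expand[of P], subst poly_expand[of Q])
       (simp only: sum_product Poly_Mapping.mult_single)
  also have "subst c v \<dots> = (\<Sum>m\<in>keys P. \<Sum>n\<in>keys Q.
      (c (lookup P m) * monom_value v m) * (c (lookup Q n) * monom_value v n))"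
    by (simp add: subst_sum[OF c] ring_hom_mult[OF c] monom_value_add mult_ac)
  also have "\<dots> = subst c v P * subst c v Q"
    by (simp only: subst_def sum_product)
  finally show ?thesis .
qed

lemma subst_Const: "is_ring_hom c \<Longrightarrow> subst c v (Const a) = c a"
  by (simp add: subst_single ring_hom_0)

lemma subst_Var: "is_ring_hom c \<Longrightarrow> subst c v (Var x) = v x"
  by (simp add: subst_single ring_hom_0 ring_hom_1)

lemma ring_hom_subst: "is_ring_hom c \<Longrightarrow> is_ring_hom (subst c v)"
  by (rule is_ring_homI) (simp_all add: subst_add subst_mult subst_Const ring_hom_1 flip: single_one)

lemma ring_hom_poly_value: "is_ring_hom poly_value"
  unfolding poly_value_conv_subst by (rule ring_hom_subst[OF ring_hom_id])

lemma hom_subst: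
  assumes "is_ring_hom h"
  shows "h (subst c v P) = subst (\<lambda>a. h (c a)) (\<lambda>x. h (v x)) P"
  by (simp add: subst_def ring_hom_sum[OF assms] ring_hom_mult[OF assms] monom_value_hom[OF assms])

lemma subst_cong:
  assumes "P \<in> polys_over K X" "\<And>a. a \<in> K \<Longrightarrow> c a = c' a" "\<And>x. x \<in> X \<Longrightarrow> v x = v' x"
  shows "subst c v P = subst c' v' P"
  unfolding subst_def
proof (intro sum.cong refl arg_cong2[where f = "(*)"] monom_value_cong)
  show "c (lookup P m) = c' (lookup P m)" for m
    using assms(1,2) by (simp add: polys_over_def)
  show "v x = v' x" if "m \<in> keys P" "x \<in> keys m" for m x
    using assms(1,3) that by (auto simp: polys_over_def)
qed

lemma subst_Const_Var: "subst Const Var P = P"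
  by (simp add: subst_def monom_value_Var Poly_Mapping.mult_single flip: poly_expand)

section \<open>Graded families and weighted degrees\<close>

lemma subringD:
  assumes "is_subring K"
  shows "0 \<in> K" "1 \<in> K" "x \<in> K \<Longrightarrow> y \<in> K \<Longrightarrow> x - y \<in> K" "x \<in> K \<Longrightarrow> -x \<in> K"
    "x \<in> K \<Longrightarrow> y \<in> K \<Longrightarrow> x + y \<in> K" "x \<in> K \<Longrightarrow> y \<in> K \<Longrightarrow> x * y \<in> K"
proof -
  show 1: "1 \<in> K" and d: "\<And>x y. x \<in> K \<Longrightarrow> y \<in> K \<Longrightarrow> x - y \<in> K"
    and m: "x \<in> K \<Longrightarrow> y \<in> K \<Longrightarrow> x * y \<in> K"
    using assms by (auto simp: is_subring_def)
  show 0: "0 \<in> K" using d[OF 1 1] by simp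
  show n: "-x \<in> K" if "x \<in> K" for x using d[OF 0 that] by simp
  show "x + y \<in> K" if "x \<in> K" "y \<in> K" using d[OF that(1) n[OF that(2)]] by simp
qed

lemma subring_sum: "is_subring K \<Longrightarrow> (\<And>i. i \<in> A \<Longrightarrow> f i \<in> K) \<Longrightarrow> sum f A \<in> K"
  by (induction A rule: infinite_finite_induct) (auto intro: subringD)

lemma subring_prod: "is_subring K \<Longrightarrow> (\<And>i. i \<in> A \<Longrightarrow> f i \<in> K) \<Longrightarrow> prod f A \<in> K"
  by (induction A rule: infinite_finite_induct) (auto intro: subringD)

lemma subring_power: "is_subring K \<Longrightarrow> x \<in> K \<Longrightarrow> x ^ n \<in> K"
  by (induction n) (auto intro: subringD)

lemma subring_of_nat: "is_subring K \<Longrightarrow> of_nat n \<in> K"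
  by (induction n) (auto intro: subringD)

lemma subring_polys_over:
  assumes K: "is_subring K"
  shows "is_subring (polys_over K X)"
  unfolding is_subring_def
proof (intro conjI ballI)
  show "1 \<in> polys_over K X"
    using subringD[OF K] by (auto simp: polys_over_def lookup_one when_def)
next
  fix P Q assume P: "P \<in> polys_over K X" and Q: "Q \<in> polys_over K X"
  have "lookup (P - Q) m \<in> K" for m
    using P Q subringD(3)[OF K] by (simp add: polys_over_def lookup_minus)
  moreover have "keys m \<subseteq> X" if "m \<in> keys (P - Q)" for m
    using P Q subsetD[OF keys_diff that] unfolding polys_over_def by blast
  ultimately show "P - Q \<in> polys_over K X" by (simp add: polys_over_def)
  have 1: "lookup (P * Q) m \<in> K" for m
  proof -
    have "P * Q = (\<Sum>m\<in>keys P. \<Sum>n\<in>keys Q. single (m + n) (lookup P m * lookup Q n))"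
      by (subst poly_expand[of P], subst poly_expand[of Q])
         (simp only: sum_product Poly_Mapping.mult_single)
    then show ?thesis using P Q
      by (auto simp: lookup_sum lookup_single when_def polys_over_def
          intro!: subring_sum[OF K] subringD[OF K])
  qed
  have 2: "keys m \<subseteq> X" if m: "m \<in> keys (P * Q)" for m
  proof -
    obtain a b where "m = a + b" "a \<in> keys P" "b \<in> keys Q"
      using subsetD[OF keys_mult m] by blast
    moreover have "keys (a + b) \<subseteq> keys a \<union> keys b" by (rule keys_add)
    moreover have "keys a \<subseteq> X" "keys b \<subseteq> X"
      using P Q calculation(2,3) by (simp_all add: polys_over_def)
    ultimately show ?thesis by blast
  qed
  show "P * Q \<in> polys_over K X" using 1 2 by (auto simp: polys_over_def)
qed

text \<open>The sum of the \<open>H n\<close> need not be direct, and they need not be closed under negation. This weak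
notion passes to power series and is all that is needed to see that a substitution preserves
degrees.\<close>

definition graded_family :: "(nat \<Rightarrow> 'b::comm_ring_1 set) \<Rightarrow> bool" where
  "graded_family H \<longleftrightarrow> 1 \<in> H 0 \<and> (\<forall>n. 0 \<in> H n) \<and> (\<forall>n. \<forall>x\<in>H n. \<forall>y\<in>H n. x + y \<in> H n) \<and>
     (\<forall>m n. \<forall>x\<in>H m. \<forall>y\<in>H n. x * y \<in> H (m + n))"

lemma graded_familyD:
  assumes "graded_family H"
  shows "1 \<in> H 0" "0 \<in> H n" "x \<in> H n \<Longrightarrow> y \<in> H n \<Longrightarrow> x + y \<in> H n"
    "x \<in> H m \<Longrightarrow> z \<in> H n \<Longrightarrow> x * z \<in> H (m + n)"
  using assms by (auto simp: graded_family_def)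

context
  fixes H :: "nat \<Rightarrow> 'b::comm_ring_1 set"
  assumes H: "graded_family H"
begin

lemma graded_family_sum: "(\<And>i. i \<in> A \<Longrightarrow> f i \<in> H n) \<Longrightarrow> sum f A \<in> H n"
  by (induction A rule: infinite_finite_induct) (auto intro: graded_familyD[OF H])

lemma graded_family_prod: "(\<And>i. i \<in> A \<Longrightarrow> f i \<in> H (w i)) \<Longrightarrow> prod f A \<in> H (sum w A)"
  by (induction A rule: infinite_finite_induct) (auto intro: graded_familyD[OF H])

lemma graded_family_power: "x \<in> H n \<Longrightarrow> x ^ k \<in> H (k * n)"
  by (induction k) (auto intro: graded_familyD[OF H])

end

definition wdeg :: "('v \<Rightarrow> nat) \<Rightarrow> ('v \<Rightarrow>\<^sub>0 nat) \<Rightarrow> nat" where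
  "wdeg w m = (\<Sum>x\<in>keys m. lookup m x * w x)"

lemma wdeg_superset:
  assumes "finite A" "keys m \<subseteq> A"
  shows "wdeg w m = (\<Sum>x\<in>A. lookup m x * w x)"
  unfolding wdeg_def using assms
  by (intro sum.mono_neutral_left) (auto simp: in_keys_iff)

lemma wdeg_add: "wdeg w (m + m') = wdeg w m + wdeg w m'"
proof -
  have A: "finite (keys m \<union> keys m')" by simp
  show ?thesis
    using keys_add[of m m']
    by (simp add: wdeg_superset[OF A] lookup_add distrib_right sum.distrib)
qed

lemma wdeg_0 [simp]: "wdeg w 0 = 0"
  by (simp add: wdeg_def)

lemma wdeg_single [simp]: "wdeg w (single x n) = n * w x"
  by (simp add: wdeg_def)

lemma monom_value_graded:
  assumes "graded_family H" "\<And>x. x \<in> keys m \<Longrightarrow> v x \<in> H (w x)"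
  shows "monom_value v m \<in> H (wdeg w m)"
  unfolding monom_value_def wdeg_def
  using assms by (intro graded_family_prod graded_family_power) auto

definition hom_polys ::
  "'c::comm_ring_1 set \<Rightarrow> 'c set \<Rightarrow> ('c \<Rightarrow> nat) \<Rightarrow> nat \<Rightarrow> (('c \<Rightarrow>\<^sub>0 nat) \<Rightarrow>\<^sub>0 'c) set" where
  "hom_polys K X w d = {P \<in> polys_over K X. \<forall>m\<in>keys P. wdeg w m = d}"

lemma graded_family_hom_polys:
  assumes K: "is_subring K"
  shows "graded_family (hom_polys K X w)"
  unfolding graded_family_def
proof (intro conjI allI ballI)
  note S = subringD[OF subring_polys_over[OF K, of X]]
  show "1 \<in> hom_polys K X w 0" using S(2) by (simp add: hom_polys_def)
  show "0 \<in> hom_polys K X w n" for n using S(1) by (simp add: hom_polys_def)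
  show "P + Q \<in> hom_polys K X w n" if "P \<in> hom_polys K X w n" "Q \<in> hom_polys K X w n" for P Q n
    using that S(5)[of P Q] subsetD[OF keys_add[of P Q]] unfolding hom_polys_def by blast
  show "P * Q \<in> hom_polys K X w (a + b)"
    if PQ: "P \<in> hom_polys K X w a" "Q \<in> hom_polys K X w b" for P Q a b
  proof -
    have "wdeg w m = a + b" if m: "m \<in> keys (P * Q)" for m
    proof -
      obtain i j where "m = i + j" "i \<in> keys P" "j \<in> keys Q"
        using subsetD[OF keys_mult m] by blast
      then show ?thesis using PQ by (simp add: hom_polys_def wdeg_add)
    qed
    then show ?thesis using PQ S(6)[of P Q] by (simp add: hom_polys_def)
  qed
qed

definition hom_part ::
  "('v \<Rightarrow> nat) \<Rightarrow> nat \<Rightarrow> (('v \<Rightarrow>\<^sub>0 nat) \<Rightarrow>\<^sub>0 'c::comm_ring_1) \<Rightarrow> ('v \<Rightarrow>\<^sub>0 nat) \<Rightarrow>\<^sub>0 'c" where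
  "hom_part w k P = (\<Sum>m\<in>{m\<in>keys P. wdeg w m = k}. single m (lookup P m))"

lemma lookup_hom_part: "lookup (hom_part w k P) m = (if wdeg w m = k then lookup P m else 0)"
proof -
  have "lookup (hom_part w k P) m =
      (\<Sum>m'\<in>{m'\<in>keys P. wdeg w m' = k}. if m' = m then lookup P m else 0)"
    unfolding hom_part_def lookup_sum by (rule sum.cong) (auto simp: lookup_single when_def)
  then show ?thesis by (simp add: in_keys_iff)
qed

lemma hom_part_mem:
  assumes "is_subring K" "P \<in> polys_over K X"
  shows "hom_part w k P \<in> hom_polys K X w k"
  using assms(2) subringD(1)[OF assms(1)]
  by (auto simp: hom_polys_def polys_over_def in_keys_iff lookup_hom_part split: if_splits)

lemma sum_hom_parts: "P = (\<Sum>k\<in>wdeg w ` keys P. hom_part w k P)"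
  unfolding hom_part_def by (subst poly_expand, rule sum.group[symmetric]) auto

lemma subst_graded:
  assumes H: "graded_family H" and P: "P \<in> hom_polys K X w d"
    and c: "\<And>a. a \<in> K \<Longrightarrow> c a \<in> H 0" and v: "\<And>x. x \<in> X \<Longrightarrow> v x \<in> H (w x)"
  shows "subst c v P \<in> H d"
  unfolding subst_def
proof (rule graded_family_sum[OF H])
  fix m assume m: "m \<in> keys P"
  then have "monom_value v m \<in> H d"
    using P v monom_value_graded[OF H, of m v w] by (auto simp: hom_polys_def polys_over_def)
  then show "c (lookup P m) * monom_value v m \<in> H d"
    using graded_familyD(4)[OF H, of "c (lookup P m)" 0 "monom_value v m" d] P c
    by (auto simp: hom_polys_def polys_over_def)
qed

text \<open>Power series in a variable of degree \<open>-s\<close>, homogeneous of total degree \<open>d\<close>.\<close>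

definition hom_series :: "nat \<Rightarrow> (nat \<Rightarrow> 'b::comm_ring_1 set) \<Rightarrow> nat \<Rightarrow> 'b fps set" where
  "hom_series s H d =
     {F. \<forall>m. if m * s \<le> d then fps_nth F m \<in> H (d - m * s) else fps_nth F m = 0}"

lemma hom_series_iff:
  "F \<in> hom_series s H d \<longleftrightarrow>
     (\<forall>m. (m * s \<le> d \<longrightarrow> fps_nth F m \<in> H (d - m * s)) \<and> (d < m * s \<longrightarrow> fps_nth F m = 0))"
  by (auto simp: hom_series_def not_le)

lemma graded_family_hom_series:
  assumes H: "graded_family H"
  shows "graded_family (hom_series s H)"
proof -
  note g = graded_familyD[OF H]
  have "1 \<in> hom_series s H 0"
    using g(1,2) by (auto simp: hom_series_iff)
  moreover have "F * F' \<in> hom_series s H (d + d')"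
    if F: "F \<in> hom_series s H d" and F': "F' \<in> hom_series s H d'" for F F' d d'
  proof -
    have "if m * s \<le> d + d' then fps_nth F i * fps_nth F' (m - i) \<in> H (d + d' - m * s)
          else fps_nth F i * fps_nth F' (m - i) = 0" if "i \<le> m" for i m
    proof -
      have eq: "m * s = i * s + (m - i) * s" using that by (simp flip: distrib_right)
      show ?thesis
      proof (cases "i * s \<le> d \<and> (m - i) * s \<le> d'")
        case True
        then have "fps_nth F i * fps_nth F' (m - i) \<in> H ((d - i * s) + (d' - (m - i) * s))"
          using F F' by (intro g) (auto simp: hom_series_iff)
        moreover have "(d - i * s) + (d' - (m - i) * s) = d + d' - m * s" "m * s \<le> d + d'"
          using True eq by auto
        ultimately show ?thesis by simp
      next
        case False
        then have "fps_nth F i * fps_nth F' (m - i) = 0"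
          using F F' by (auto simp: hom_series_iff not_le)
        then show ?thesis using g(2) by simp
      qed
    qed
    then show ?thesis
      by (auto simp: hom_series_def fps_mult_nth intro!: graded_family_sum[OF H] sum.neutral)
  qed
  ultimately show ?thesis
    using g(2,3) by (auto simp: graded_family_def hom_series_iff)
qed

lemma fps_const_hom_series: "graded_family H \<Longrightarrow> a \<in> H d \<Longrightarrow> fps_const a \<in> hom_series s H d"
  using graded_familyD(2)[of H] by (auto simp: hom_series_iff)

lemma fps_X_hom_series: "graded_family H \<Longrightarrow> fps_X \<in> hom_series s H s"
  using graded_familyD(1,2)[of H] by (auto simp: hom_series_iff fps_X_def)

section \<open>Homogeneous components\<close>

locale graded_char_p = graded_ring G for G :: "nat \<Rightarrow> 'a::comm_ring_1 set" +
  fixes p :: nat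
  assumes subfield: "is_subfield (G 0)" and prime_p: "prime p" and char_p: "CHAR('a) = p"
begin

abbreviation K :: "'a set" where "K \<equiv> G 0"

lemma subring_K: "is_subring K" using subfield by (simp add: is_subfield_def)

lemma K_inverse: "a \<in> K \<Longrightarrow> a \<noteq> 0 \<Longrightarrow> \<exists>b\<in>K. a * b = 1"
  using subfield by (simp add: is_subfield_def)

lemma K_no_zero_div: "a \<in> K \<Longrightarrow> a \<noteq> 0 \<Longrightarrow> a * x = 0 \<Longrightarrow> x = 0"
  by (metis K_inverse mult.assoc mult.commute mult_1 mult_zero_right)

lemma K_power_eq_0: "a \<in> K \<Longrightarrow> a ^ n = 0 \<Longrightarrow> a = 0"
proof (induction n)
  case (Suc n)
  then show ?case using K_no_zero_div[of a "a ^ n"] by auto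
qed auto

lemma p_pos: "p > 0" and p_gt_1: "p > 1"
  using prime_p prime_gt_0_nat prime_gt_1_nat by blast+

lemma uminus_mem: "x \<in> G n \<Longrightarrow> -x \<in> G n"
  using diff_mem[OF zero_mem, of x n] by simp

lemma add_mem: "x \<in> G n \<Longrightarrow> y \<in> G n \<Longrightarrow> x + y \<in> G n"
  using diff_mem[OF _ uminus_mem, of x n y] by simp

lemma graded_G: "graded_family G"
  by (simp add: graded_family_def one_mem zero_mem add_mem mult_mem)

lemmas sum_mem = graded_family_sum[OF graded_G]
lemmas power_mem = graded_family_power[OF graded_G]

lemma scale_mem: "c \<in> K \<Longrightarrow> x \<in> G n \<Longrightarrow> c * x \<in> G n"
  using mult_mem[of c 0 x n] by simp

lemma ring_hom_power_p: "is_ring_hom (\<lambda>x::'a. x ^ p)"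
  using freshmans_dream[where 'a = 'a] prime_p char_p
  by (intro is_ring_homI) (auto simp: power_mult_distrib)

lemma power_p_add: "(x + y :: 'a) ^ p = x ^ p + y ^ p"
  by (rule ring_hom_add[OF ring_hom_power_p])

definition component :: "'a \<Rightarrow> nat \<Rightarrow> 'a" where
  "component x = (THE c. (\<forall>n. c n \<in> G n) \<and> finite {n. c n \<noteq> 0} \<and> x = (\<Sum>n | c n \<noteq> 0. c n))"

lemma component_mem: "component x n \<in> G n"
  and finite_component: "finite {n. component x n \<noteq> 0}"
  and sum_component: "x = (\<Sum>n | component x n \<noteq> 0. component x n)"
proof -
  have *: "(\<forall>n. component x n \<in> G n) \<and> finite {n. component x n \<noteq> 0} \<and>
      x = (\<Sum>n | component x n \<noteq> 0. component x n)"
    unfolding component_def by (rule theI'[OF direct_sum[of x]])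
  from * show "component x n \<in> G n" by (elim conjE allE)
  from * show "finite {n. component x n \<noteq> 0}" by (elim conjE)
  from * show "x = (\<Sum>n | component x n \<noteq> 0. component x n)" by (elim conjE)
qed

lemma component_unique:
  assumes "\<And>n. f n \<in> G n" "finite A" "x = (\<Sum>n\<in>A. f n)" "\<And>n. n \<notin> A \<Longrightarrow> f n = 0"
  shows "component x = f"
proof -
  have sub: "{n. f n \<noteq> 0} \<subseteq> A" using assms(4) by auto
  have "x = (\<Sum>n | f n \<noteq> 0. f n)"
    unfolding assms(3) using assms(2) sub by (intro sum.mono_neutral_right) auto
  then have "(\<forall>n. f n \<in> G n) \<and> finite {n. f n \<noteq> 0} \<and> x = (\<Sum>n | f n \<noteq> 0. f n)"
    using assms(1) finite_subset[OF sub assms(2)] by simp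
  then show ?thesis
    unfolding component_def by (intro the1_equality[OF direct_sum])
qed

lemma component_homogeneous: "x \<in> G n \<Longrightarrow> component x = (\<lambda>m. if m = n then x else 0)"
  by (rule component_unique[where A = "{n}"]) (auto simp: zero_mem)

lemma component_self: "x \<in> G n \<Longrightarrow> component x n = x"
  by (simp add: component_homogeneous)

lemma homogeneous_unique: "x \<in> G m \<Longrightarrow> x \<in> G n \<Longrightarrow> m \<noteq> n \<Longrightarrow> x = 0"
  by (metis component_homogeneous)

lemma component_0: "component 0 n = 0"
  by (simp add: component_homogeneous[OF zero_mem[of n]])

lemma component_add: "component (x + y) n = component x n + component y n"
proof -
  let ?A = "{n. component x n \<noteq> 0} \<union> {n. component y n \<noteq> 0}"
  have A: "finite ?A" by (simp add: finite_component)
  have "(\<Sum>n\<in>?A. component z n) = z" if "{n. component z n \<noteq> 0} \<subseteq> ?A" for z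
    by (subst (2) sum_component[of z], rule sum.mono_neutral_right[OF A that]) auto
  then have "x + y = (\<Sum>n\<in>?A. component x n + component y n)"
    by (simp add: sum.distrib)
  from component_unique[OF _ A this] show ?thesis
    by (auto simp: add_mem component_mem)
qed

lemma component_sum: "component (sum g A) n = (\<Sum>i\<in>A. component (g i) n)"
  by (induction A rule: infinite_finite_induct) (auto simp: component_0 component_add)

lemma poly_value_mem:
  assumes "P \<in> hom_polys K X w d" "\<And>x. x \<in> X \<Longrightarrow> x \<in> G (w x)"
  shows "poly_value P \<in> G d"
  unfolding poly_value_conv_subst by (rule subst_graded[OF graded_G assms(1)]) (use assms(2) in auto)

lemma component_poly_value:
  assumes P: "P \<in> polys_over K X" and X: "\<And>x. x \<in> X \<Longrightarrow> x \<in> G (w x)"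
  shows "component (poly_value P) k = poly_value (hom_part w k P)"
proof -
  let ?N = "wdeg w ` keys P"
  have outside: "poly_value (hom_part w k P) = 0" if "k \<notin> ?N" for k
  proof -
    have "hom_part w k P = 0"
      by (rule poly_mapping_eqI) (use that in \<open>auto simp: lookup_hom_part in_keys_iff\<close>)
    then show ?thesis by (simp add: ring_hom_0[OF ring_hom_poly_value])
  qed
  have "poly_value P = (\<Sum>k\<in>?N. poly_value (hom_part w k P))"
    by (subst (1) sum_hom_parts[of P w]) (rule ring_hom_sum[OF ring_hom_poly_value])
  then have "component (poly_value P) = (\<lambda>k. poly_value (hom_part w k P))"
    by (intro component_unique[of _ ?N] outside poly_value_mem[OF hom_part_mem[OF subring_K P] X]) auto
  then show ?thesis by simp
qed

end

section \<open>Frobenius and Hasse derivations\<close>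

text \<open>In characteristic \<open>p\<close> the coefficients of \<open>F\<^sup>p\<close> are the \<open>p\<close>-th powers of those of \<open>F\<close>:
  write \<open>F = a + T * F'\<close> and use the additivity of Frobenius.\<close>

lemma fps_nth_power_char:
  fixes F :: "'b::comm_ring_1 fps"
  assumes "prime p" "CHAR('b) = p"
  shows "fps_nth (F ^ p) (p * m) = fps_nth F m ^ p"
proof (induction m arbitrary: F)
  case 0
  show ?case by (simp add: fps_power_zeroth)
next
  case (Suc m)
  have p: "p > 0" using assms(1) prime_gt_0_nat by blast
  have "F = fps_const (fps_nth F 0) + fps_X * fps_shift 1 F"
    by (simp add: fps_eq_iff)
  then have "F ^ p = (fps_const (fps_nth F 0) + fps_X * fps_shift 1 F) ^ p" by simp
  also have "\<dots> = fps_const (fps_nth F 0 ^ p) + fps_X ^ p * fps_shift 1 F ^ p"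
    using assms by (subst freshmans_dream) (auto simp: power_mult_distrib fps_const_power)
  finally have "fps_nth (F ^ p) (p * Suc m) = fps_nth (fps_shift 1 F ^ p) (p * m)"
    using p by (simp add: fps_X_power_mult_nth)
  also have "\<dots> = fps_nth F (Suc m) ^ p" by (simp add: Suc.IH)
  finally show ?case .
qed

text \<open>The Leibniz rule says exactly that \<open>x \<mapsto> \<Sum>\<^sub>n \<delta>\<^sub>n(x) T\<^sup>n\<close> is multiplicative: a Hasse derivation is a
ring homomorphism into power series that is the identity modulo \<open>T\<close>.\<close>

definition hasse_series :: "(nat \<Rightarrow> 'a \<Rightarrow> 'a) \<Rightarrow> 'a::comm_ring_1 \<Rightarrow> 'a fps" where
  "hasse_series \<delta> x = Abs_fps (\<lambda>n. \<delta> n x)"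

lemma hasse_series_nth [simp]: "fps_nth (hasse_series \<delta> x) n = \<delta> n x"
  by (simp add: hasse_series_def)

lemma hasse_derivation_one:
  assumes "hasse_derivation \<delta>" "n > 0"
  shows "\<delta> n 1 = 0"
  using assms(2)
proof (induction n rule: less_induct)
  case (less n)
  have "\<delta> n (1 * 1) = (\<Sum>i\<le>n. \<delta> i 1 * \<delta> (n - i) 1)"
    using assms(1) unfolding hasse_derivation_def by blast
  also have "\<dots> = (\<Sum>i\<in>{0,n}. \<delta> i 1 * \<delta> (n - i) 1)"
    using less by (intro sum.mono_neutral_right) auto
  also have "\<dots> = \<delta> n 1 + \<delta> n 1"
    using less.prems assms(1) by (simp add: hasse_derivation_def)
  finally show ?case by simp
qed

lemma ring_hom_hasse_series:
  assumes "hasse_derivation \<delta>"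
  shows "is_ring_hom (hasse_series \<delta>)"
proof (rule is_ring_homI)
  show "hasse_series \<delta> 1 = 1"
    using assms hasse_derivation_one[OF assms] by (auto simp: fps_eq_iff hasse_derivation_def)
  show "hasse_series \<delta> (x + y) = hasse_series \<delta> x + hasse_series \<delta> y" for x y
    using assms by (simp add: fps_eq_iff hasse_derivation_def additive.add)
  show "hasse_series \<delta> (x * y) = hasse_series \<delta> x * hasse_series \<delta> y" for x y
    using assms by (simp add: fps_eq_iff hasse_derivation_def fps_mult_nth atLeast0AtMost)
qed

lemma hasse_derivation_of_series:
  assumes "is_ring_hom f" "\<And>x. fps_nth (f x) 0 = x"
  shows "hasse_derivation (\<lambda>n x. fps_nth (f x) n)"
  using assms ring_hom_add[OF assms(1)] ring_hom_mult[OF assms(1)]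
  by (auto simp: hasse_derivation_def additive_def fun_eq_iff fps_mult_nth atLeast0AtMost)

section \<open>Constants of an admissible set\<close>

locale F_data = graded_char_p G p for G :: "nat \<Rightarrow> 'a::comm_ring_1 set" and p +
  fixes \<phi> \<sigma> :: "'a \<Rightarrow> 'a" and \<D> :: "(nat \<Rightarrow> 'a \<Rightarrow> 'a) set"
  assumes F_fact: "F_factorization p G \<phi> \<sigma>" and adm: "admissible p G \<phi> \<sigma> \<D>"
begin

lemma hom_\<phi>: "is_ring_hom \<phi>" and hom_\<sigma>: "is_ring_hom \<sigma>" and inj_\<phi>: "inj \<phi>"
  and \<phi>_mem: "x \<in> G n \<Longrightarrow> \<phi> x \<in> G n" and \<sigma>_K: "a \<in> K \<Longrightarrow> \<sigma> a = a"
  and \<phi>\<sigma>: "\<phi> (\<sigma> x) = x ^ p"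
  using F_fact by (auto simp: F_factorization_def fun_eq_iff)

lemma hasse: "\<delta> \<in> \<D> \<Longrightarrow> hasse_derivation \<delta>"
  and hasse_\<phi>: "\<delta> \<in> \<D> \<Longrightarrow> \<delta> n (\<phi> x) = \<phi> (\<delta> n x)"
  using adm by (auto simp: admissible_def fun_eq_iff)

lemma hom_hasse: "\<delta> \<in> \<D> \<Longrightarrow> is_ring_hom (hasse_series \<delta>)"
  by (intro ring_hom_hasse_series hasse)

lemma hasse_zero: "\<delta> \<in> \<D> \<Longrightarrow> \<delta> n 0 = 0"
  using ring_hom_0[OF hom_hasse] by (metis fps_zero_nth hasse_series_nth)

lemma hasse_degree:
  assumes "\<delta> \<in> \<D>"
  obtains s where "s > 0" "\<And>x n. x \<in> G n \<Longrightarrow> hasse_series \<delta> x \<in> hom_series s G n"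
proof -
  obtain d where d: "d < 0" "hasse_homogeneous G d \<delta>"
    using adm assms by (auto simp: admissible_def)
  define s where "s = nat (-d)"
  have s: "d = - int s" "s > 0" using d(1) by (auto simp: s_def)
  have "hasse_series \<delta> x \<in> hom_series s G n" if x: "x \<in> G n" for x n
    unfolding hom_series_iff
  proof (intro allI conjI impI)
    fix m
    have h: "if int n + int m * d < 0 then \<delta> m x = 0 else \<delta> m x \<in> G (nat (int n + int m * d))"
      using d(2) x by (auto simp: hasse_homogeneous_def Let_def)
    have e: "int n + int m * d = int n - int (m * s)" using s(1) by simp
    show "fps_nth (hasse_series \<delta> x) m \<in> G (n - m * s)" if "m * s \<le> n"
      using h that unfolding e by (simp add: nat_diff_distrib del: of_nat_mult)
    show "fps_nth (hasse_series \<delta> x) m = 0" if "n < m * s"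
      using h that unfolding e by (simp del: of_nat_mult)
  qed
  then show ?thesis using that s(2) by blast
qed

lemma hasse_K: "\<delta> \<in> \<D> \<Longrightarrow> a \<in> K \<Longrightarrow> hasse_series \<delta> a = fps_const a"
proof -
  assume \<delta>: "\<delta> \<in> \<D>" and a: "a \<in> K"
  obtain s where s: "s > 0" "hasse_series \<delta> a \<in> hom_series s G 0"
    using hasse_degree[OF \<delta>] a by metis
  then have "\<delta> n a = 0" if "n > 0" for n
    using that by (auto simp: hom_series_iff)
  then show ?thesis
    using hasse[OF \<delta>] by (auto simp: fps_eq_iff hasse_derivation_def)
qed

lemma hasse_linear:
  assumes "\<delta> \<in> \<D>" "\<And>i. i \<in> I \<Longrightarrow> c i \<in> K"
  shows "\<delta> n (\<Sum>i\<in>I. c i * y i) = (\<Sum>i\<in>I. c i * \<delta> n (y i))"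
proof -
  have "hasse_series \<delta> (\<Sum>i\<in>I. c i * y i) = (\<Sum>i\<in>I. fps_const (c i) * hasse_series \<delta> (y i))"
    using assms by (simp add: ring_hom_sum[OF hom_hasse] ring_hom_mult[OF hom_hasse] hasse_K)
  then have "fps_nth (hasse_series \<delta> (\<Sum>i\<in>I. c i * y i)) n =
      fps_nth (\<Sum>i\<in>I. fps_const (c i) * hasse_series \<delta> (y i)) n" by simp
  then show ?thesis by (simp add: fps_sum_nth)
qed

lemma hasse_power_p: "\<delta> \<in> \<D> \<Longrightarrow> \<delta> (p * m) (x ^ p) = \<delta> m x ^ p"
  using fps_nth_power_char[OF prime_p char_p, of "hasse_series \<delta> x" m]
  by (metis hasse_series_nth hom_hasse ring_hom_power)

text \<open>Cancel the injective \<open>\<phi>\<close> from \<open>\<delta> (p * m) (x\<^sup>p) = (\<delta> m x)\<^sup>p\<close>.\<close>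

lemma hasse_\<sigma>: "\<delta> \<in> \<D> \<Longrightarrow> \<delta> (p * m) (\<sigma> x) = \<sigma> (\<delta> m x)"
proof -
  assume \<delta>: "\<delta> \<in> \<D>"
  have "\<phi> (\<delta> (p * m) (\<sigma> x)) = \<phi> (\<sigma> (\<delta> m x))"
    by (simp add: \<phi>\<sigma> hasse_power_p[OF \<delta>] flip: hasse_\<phi>[OF \<delta>])
  then show ?thesis using inj_\<phi> by (simp add: inj_eq)
qed

lemma component_\<phi>: "component (\<phi> x) n = \<phi> (component x n)"
proof -
  have "component (\<phi> x) = (\<lambda>n. \<phi> (component x n))"
  proof (rule component_unique[OF _ finite_component])
    show "\<phi> (component x n) \<in> G n" for n by (intro \<phi>_mem component_mem)
    show "\<phi> x = (\<Sum>n | component x n \<noteq> 0. \<phi> (component x n))"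
      by (subst sum_component[of x]) (simp add: ring_hom_sum[OF hom_\<phi>])
  qed (auto simp: ring_hom_0[OF hom_\<phi>])
  then show ?thesis by simp
qed

text \<open>\<open>\<sigma>\<close> is not assumed to respect the grading, but \<open>\<phi>\<close> is injective and preserves degrees, so
\<open>\<phi> (\<sigma> x) = x\<^sup>p\<close> forces \<open>\<sigma>\<close> to multiply degrees by \<open>p\<close>.\<close>

lemma \<sigma>_mem:
  assumes "x \<in> G n"
  shows "\<sigma> x \<in> G (p * n)"
proof -
  have *: "\<phi> (component (\<sigma> x) m) = (if m = p * n then \<phi> (\<sigma> x) else 0)" for m
    unfolding component_\<phi>[symmetric] \<phi>\<sigma>
    by (simp add: component_homogeneous[OF power_mem[OF assms]])
  have "component (\<sigma> x) (p * n) = \<sigma> x"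
    using *[of "p * n"] inj_\<phi> by (simp add: inj_eq)
  then show ?thesis by (metis component_mem)
qed

lemma in_range_\<sigma>_homogeneous:
  assumes x: "x \<in> G n" "x \<noteq> 0" "x \<in> range \<sigma>"
  obtains a y where "n = p * a" "y \<in> G a" "x = \<sigma> y"
proof -
  obtain y where y: "x = \<sigma> y" using x(3) by blast
  let ?A = "{a. component y a \<noteq> 0}"
  have "\<sigma> y = (\<Sum>a\<in>?A. \<sigma> (component y a))"
    by (subst sum_component[of y]) (simp add: ring_hom_sum[OF hom_\<sigma>])
  then have "x = component (\<Sum>a\<in>?A. \<sigma> (component y a)) n"
    using y component_self[OF x(1)] by simp
  also have "\<dots> = (\<Sum>a\<in>?A. if n = p * a then \<sigma> (component y a) else 0)"
    by (simp add: component_sum component_homogeneous[OF \<sigma>_mem[OF component_mem]])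
  finally have eq: "x = (\<Sum>a\<in>?A. if n = p * a then \<sigma> (component y a) else 0)" .
  have "\<exists>a. n = p * a"
  proof (rule ccontr)
    assume "\<not> ?thesis"
    then have "x = 0" by (subst eq) (auto intro: sum.neutral)
    then show False using x(2) by blast
  qed
  then obtain a where a: "n = p * a" ..
  have "x = (\<Sum>b\<in>?A. if b = a then \<sigma> (component y a) else 0)"
    by (subst eq, rule sum.cong) (use a p_pos in auto)
  also have "\<dots> = \<sigma> (component y a)"
    using finite_component[of y] by (auto simp: ring_hom_0[OF hom_\<sigma>])
  finally show ?thesis using that[OF a component_mem] by blast
qed

text \<open>The case \<open>s = 0\<close> of the last admissibility condition; the preimage under \<open>\<sigma>\<close> can be taken
  homogeneous because \<open>\<sigma>\<close> multiplies degrees by \<open>p\<close>.\<close>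

lemma first_derivatives_zero:
  assumes "x \<in> G n" "x \<noteq> 0" "\<And>\<delta>. \<delta> \<in> \<D> \<Longrightarrow> \<delta> 1 x = 0"
  obtains a y where "n = p * a" "y \<in> G a" "x = \<sigma> y"
proof -
  have span: "lin_span [] (range \<phi>) = {0}" by (simp add: lin_span_def)
  have "homogeneous G x" using assms(1) by (auto simp: homogeneous_def)
  moreover have "\<forall>\<delta>\<in>\<D>. hasse_bracket p \<delta> 0 x \<in> lin_span [] (range \<phi>)"
    using assms(3) by (simp add: hasse_bracket_def span)
  moreover have "set [] \<subseteq> K" by simp
  ultimately have "x \<in> {a + b |a b. a \<in> range \<sigma> \<and> b \<in> lin_span [] (range \<phi>)}"
    using adm unfolding admissible_def by blast
  then have "x \<in> range \<sigma>" by (auto simp: span)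
  then show ?thesis using in_range_\<sigma>_homogeneous[OF assms(1,2)] that by blast
qed

text \<open>Reducedness: the coefficients of \<open>hasse_series \<delta> x\<close> are nilpotent with \<open>x\<close>, so a nilpotent
  \<open>x\<close> of minimal degree has no derivatives, hence is \<open>\<sigma> y\<close> for a nilpotent \<open>y\<close> of lower degree.\<close>

lemma homogeneous_nilpotent:
  assumes "x \<in> G n" "x ^ (p ^ k) = 0"
  shows "x = 0"
  using assms
proof (induction n arbitrary: x k rule: less_induct)
  case (less n)
  show ?case
  proof (cases "n = 0")
    case True
    then show ?thesis using less.prems K_power_eq_0 by blast
  next
    case False
    have "\<delta> 1 x = 0" if \<delta>: "\<delta> \<in> \<D>" for \<delta>
    proof -
      obtain s where s: "s > 0" "hasse_series \<delta> x \<in> hom_series s G n"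
        using hasse_degree[OF \<delta>] less.prems(1) by metis
      have pow: "\<delta> (p ^ j * m) (y ^ (p ^ j)) = \<delta> m y ^ (p ^ j)" for j m y
      proof (induction j arbitrary: m y)
        case (Suc j)
        have "\<delta> (p ^ Suc j * m) (y ^ (p ^ Suc j)) = \<delta> (p ^ j * (p * m)) ((y ^ p) ^ (p ^ j))"
          by (simp add: mult_ac flip: power_mult)
        also have "\<dots> = \<delta> m y ^ (p ^ Suc j)"
          unfolding Suc hasse_power_p[OF \<delta>] by (simp flip: power_mult)
        finally show ?case .
      qed simp
      have "\<delta> 1 x ^ (p ^ k) = 0"
        using pow[where j = k and m = 1 and y = x] less.prems(2) hasse_zero[OF \<delta>] by simp
      then show ?thesis
        using s False less.IH[of "n - s" "\<delta> 1 x" k] unfolding hom_series_iff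
        by (metis bot_nat_0.not_eq_extremum diff_less hasse_series_nth mult_1 not_le)
    qed
    then show ?thesis
    proof (rule_tac ccontr)
      assume "x \<noteq> 0" and d: "\<And>\<delta>. \<delta> \<in> \<D> \<Longrightarrow> \<delta> 1 x = 0"
      then obtain a y where y: "n = p * a" "y \<in> G a" "x = \<sigma> y"
        using first_derivatives_zero[OF less.prems(1)] by blast
      have "y ^ (p ^ Suc k) = \<phi> (x ^ (p ^ k))"
        by (simp add: y(3) ring_hom_power[OF hom_\<phi>] \<phi>\<sigma> power_mult)
      also have "\<dots> = 0" by (simp add: less.prems(2) ring_hom_0[OF hom_\<phi>])
      finally have "y = 0"
        using less.IH[OF _ y(2), of "Suc k"] y(1) False p_gt_1 by simp
      then show False using \<open>x \<noteq> 0\<close> y(3) ring_hom_0[OF hom_\<sigma>] by simp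
    qed
  qed
qed

lemma \<sigma>_eq_0: "x \<in> G n \<Longrightarrow> \<sigma> x = 0 \<Longrightarrow> x = 0"
  using homogeneous_nilpotent[of x n 1] \<phi>\<sigma>[of x] ring_hom_0[OF hom_\<phi>] by simp

text \<open>The only elements killed by all \<open>\<delta>\<^sub>m\<close> with \<open>m > 0\<close> are those of the base field. If \<open>x\<close> is killed,
then \<open>x = \<sigma> y\<close>, and \<open>\<sigma> (\<delta>\<^sub>m y) = \<delta>\<^bsub>p m\<^esub> x = 0\<close> shows that \<open>y\<close> is killed as well, since \<open>\<sigma>\<close> is injective
on homogeneous elements. The degree of \<open>y\<close> is smaller by a factor of \<open>p\<close>.\<close>

lemma constants:
  assumes "x \<in> G n" "\<And>\<delta> m. \<delta> \<in> \<D> \<Longrightarrow> m > 0 \<Longrightarrow> \<delta> m x = 0" "n > 0"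
  shows "x = 0"
  using assms
proof (induction n arbitrary: x rule: less_induct)
  case (less n)
  show ?case
  proof (rule ccontr)
    assume "x \<noteq> 0"
    then obtain a y where y: "n = p * a" "y \<in> G a" "x = \<sigma> y"
      using first_derivatives_zero[OF less.prems(1)] less.prems(2) by (metis zero_less_one)
    have "\<delta> m y = 0" if \<delta>: "\<delta> \<in> \<D>" and m: "m > 0" for \<delta> m
    proof -
      have "\<sigma> (\<delta> m y) = 0"
        using hasse_\<sigma>[OF \<delta>, of m y] less.prems(2)[OF \<delta>, of "p * m"] m p_pos y(3) by simp
      moreover obtain s where "hasse_series \<delta> y \<in> hom_series s G a"
        using hasse_degree[OF \<delta>] y(2) by metis
      ultimately show ?thesis
        using \<sigma>_eq_0 unfolding hom_series_iff by (metis hasse_series_nth not_le)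
    qed
    then have "y = 0" using less.IH[OF _ y(2)] y(1) less.prems(3) p_gt_1 by simp
    then show False using \<open>x \<noteq> 0\<close> y(3) ring_hom_0[OF hom_\<sigma>] by simp
  qed
qed

section \<open>Linear disjointness from the \<open>p\<close>-th powers\<close>

text \<open>Coefficients that are independent over the \<open>p\<close>-th powers of the base field remain independent over
the \<open>p\<close>-th powers of the ring: applying \<open>\<delta>\<^bsub>p m\<^esub>\<close> to a relation \<open>\<Sum>\<^sub>i c\<^sub>i y\<^sub>i\<^sup>p = 0\<close> yields
\<open>\<Sum>\<^sub>i c\<^sub>i (\<delta>\<^sub>m y\<^sub>i)\<^sup>p = 0\<close>, which has lower degree. Inductively all \<open>\<delta>\<^sub>m y\<^sub>i\<close> vanish, and then so do
the \<open>y\<^sub>i\<close>.\<close>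

lemma p_independent_constants:
  assumes "\<And>i. i \<in> I \<Longrightarrow> c i \<in> K"
    and indep: "\<And>l. (\<And>i. i \<in> I \<Longrightarrow> l i \<in> K) \<Longrightarrow> (\<Sum>i\<in>I. c i * l i ^ p) = 0 \<Longrightarrow> \<forall>i\<in>I. l i = 0"
    and "\<And>i. i \<in> I \<Longrightarrow> y i \<in> G n" "(\<Sum>i\<in>I. c i * y i ^ p) = 0"
  shows "\<forall>i\<in>I. y i = 0"
  using assms(3,4)
proof (induction n arbitrary: y rule: less_induct)
  case (less n)
  show ?case
  proof (cases "n = 0")
    case True
    then show ?thesis using indep less.prems by blast
  next
    case False
    have "\<forall>i\<in>I. \<delta> m (y i) = 0" if \<delta>: "\<delta> \<in> \<D>" and m: "m > 0" for \<delta> m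
    proof -
      obtain s where s: "s > 0" "\<And>x k. x \<in> G k \<Longrightarrow> hasse_series \<delta> x \<in> hom_series s G k"
        using hasse_degree[OF \<delta>] by metis
      have sum: "(\<Sum>i\<in>I. c i * \<delta> m (y i) ^ p) = 0"
        using hasse_linear[OF \<delta>, where I = I and c = c and n = "p * m" and y = "\<lambda>i. y i ^ p"]
          assms(1) less.prems(2)
        by (simp add: hasse_power_p[OF \<delta>] hasse_zero[OF \<delta>])
      show ?thesis
      proof (cases "m * s \<le> n")
        case True
        then have "\<delta> m (y i) \<in> G (n - m * s)" if "i \<in> I" for i
          using s(2)[OF less.prems(1)[OF that]] by (simp add: hom_series_iff)
        then show ?thesis using less.IH[OF _ _ sum, of "n - m * s"] False m s(1) by simp
      next
        case False
        then show ?thesis using s(2)[OF less.prems(1)] by (simp add: hom_series_iff)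
      qed
    qed
    then show ?thesis using constants[OF less.prems(1)] False by blast
  qed
qed

text \<open>This takes the place of extracting \<open>p\<close>-th roots of the coefficients, which is possible only over a
perfect field. As long as the \<open>c\<^sub>i\<close> are dependent over the \<open>p\<close>-th powers, a relation
\<open>c\<^sub>j = - \<Sum>\<^sub>i c\<^sub>i r\<^sub>i\<^sup>p\<close> eliminates \<open>c\<^sub>j\<close> at the cost of replacing \<open>y\<^sub>i\<close> by \<open>y\<^sub>i - r\<^sub>i y\<^sub>j\<close>, and a
dependence between the new elements is one between the old ones.\<close>

lemma p_linear_disjoint:
  assumes "finite I" "\<And>i. i \<in> I \<Longrightarrow> c i \<in> K" "\<And>i. i \<in> I \<Longrightarrow> y i \<in> G n"
    and "(\<Sum>i\<in>I. c i * y i ^ p) = 0" "\<exists>i\<in>I. c i \<noteq> 0"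
  shows "\<exists>l. (\<forall>i. l i \<in> K) \<and> (\<exists>i\<in>I. l i \<noteq> 0) \<and> (\<Sum>i\<in>I. l i * y i) = 0"
  using assms
proof (induction I arbitrary: y rule: finite_psubset_induct)
  case (psubset I)
  show ?case
  proof (cases "\<exists>l. (\<forall>i\<in>I. l i \<in> K) \<and> (\<Sum>i\<in>I. c i * l i ^ p) = 0 \<and> (\<exists>i\<in>I. l i \<noteq> 0)")
    case False
    then have "\<forall>i\<in>I. y i = 0"
      using p_independent_constants[of I c, OF psubset.prems(1) _ psubset.prems(2,3)] by blast
    \<comment> \<open>all \<open>y i\<close> vanish, so any nonzero coefficients will do\<close>
    then show ?thesis
      using psubset.prems(4) by (intro exI[of _ "\<lambda>_. 1"]) (auto simp: one_mem)
  next
    case True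
    then obtain l j where l: "\<And>i. i \<in> I \<Longrightarrow> l i \<in> K" "(\<Sum>i\<in>I. c i * l i ^ p) = 0"
      and j: "j \<in> I" "l j \<noteq> 0" by blast
    obtain b where b: "b \<in> K" "l j * b = 1" using K_inverse[OF l(1)[OF j(1)] j(2)] by blast
    define r where "r i = b * l i" for i
    let ?J = "I - {j}"
    have r: "r i \<in> K" if "i \<in> I" for i using l(1)[OF that] b(1) by (simp add: r_def scale_mem)
    have rj: "r j = 1" using b(2) by (simp add: r_def mult.commute)
    have split: "(\<Sum>i\<in>I. f i) = f j + (\<Sum>i\<in>?J. f i)" for f :: "_ \<Rightarrow> 'a"
      using psubset.hyps j(1) by (simp add: sum.remove)
    have "(\<Sum>i\<in>I. c i * r i ^ p) = b ^ p * (\<Sum>i\<in>I. c i * l i ^ p)"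
      by (simp add: r_def power_mult_distrib sum_distrib_left mult_ac)
    then have cj: "c j = - (\<Sum>i\<in>?J. c i * r i ^ p)"
      using l(2) split[of "\<lambda>i. c i * r i ^ p"] rj by (simp add: eq_neg_iff_add_eq_0)
    define z where "z i = y i - r i * y j" for i
    have z: "z i \<in> G n" if "i \<in> ?J" for i
      using that psubset.prems(2) r j(1) by (auto simp: z_def intro!: diff_mem scale_mem)
    have "z i ^ p = y i ^ p - r i ^ p * y j ^ p" for i
      using ring_hom_diff[OF ring_hom_power_p] by (simp add: z_def power_mult_distrib)
    then have "(\<Sum>i\<in>?J. c i * z i ^ p) =
        (\<Sum>i\<in>?J. c i * y i ^ p) - (\<Sum>i\<in>?J. c i * r i ^ p) * y j ^ p"
      by (simp add: right_diff_distrib sum_subtractf sum_distrib_right mult.assoc)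
    also have "\<dots> = (\<Sum>i\<in>I. c i * y i ^ p)"
      using split[of "\<lambda>i. c i * y i ^ p"] by (simp add: cj)
    finally have z0: "(\<Sum>i\<in>?J. c i * z i ^ p) = 0" using psubset.prems(3) by simp
    have "\<exists>i\<in>?J. c i \<noteq> 0"
    proof (rule ccontr)
      assume "\<not> ?thesis"
      then have "\<forall>i\<in>?J. c i = 0" by blast
      then show False using psubset.prems(4) cj by auto
    qed
    moreover have "?J \<subset> I" using j(1) by blast
    moreover have "c i \<in> K" if "i \<in> ?J" for i using psubset.prems(1) that by blast
    ultimately obtain u where u: "\<And>i. u i \<in> K" "\<exists>i\<in>?J. u i \<noteq> 0" "(\<Sum>i\<in>?J. u i * z i) = 0"
      using psubset.IH[of ?J z] z z0 by blast
    define v where "v = u(j := - (\<Sum>i\<in>?J. u i * r i))"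
    have "v i \<in> K" for i
      using u(1) r by (auto simp: v_def intro!: uminus_mem sum_mem scale_mem)
    moreover have "\<exists>i\<in>I. v i \<noteq> 0" using u(2) by (auto simp: v_def)
    moreover have "(\<Sum>i\<in>I. v i * y i) = (\<Sum>i\<in>?J. u i * z i)"
      unfolding split[of "\<lambda>i. v i * y i"]
      by (simp add: v_def z_def right_diff_distrib sum_subtractf sum_distrib_right mult.assoc)
    ultimately show ?thesis using u(3) by auto
  qed
qed

end

section \<open>Formal partial derivatives\<close>

lemma poly_induct [consumes 1, case_names Const Var add mult]:
  assumes P: "P \<in> polys_over UNIV X"
    and C: "\<And>c. Q (Const c)" and V: "\<And>x. x \<in> X \<Longrightarrow> Q (Var x)"
    and add: "\<And>P P'. Q P \<Longrightarrow> Q P' \<Longrightarrow> Q (P + P')"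
    and mult: "\<And>P P'. Q P \<Longrightarrow> Q P' \<Longrightarrow> Q (P * P')"
  shows "Q P"
proof -
  have one: "Q 1" using C[of 1] by simp
  have zero: "Q 0" using C[of 0] by simp
  have pow: "Q (Var x ^ n)" if "x \<in> X" for x n
    by (induction n) (auto intro: one mult V that)
  have prod: "Q (prod g A)" if "\<And>i. i \<in> A \<Longrightarrow> Q (g i)" for g and A :: "'a set"
    using that by (induction A rule: infinite_finite_induct) (auto intro: one mult)
  have sum: "Q (sum g A)" if "\<And>i. i \<in> A \<Longrightarrow> Q (g i)" for g and A :: "('a \<Rightarrow>\<^sub>0 nat) set"
    using that by (induction A rule: infinite_finite_induct) (auto intro: zero add)
  have "Q (subst Const Var P)"
    unfolding subst_def monom_value_def using P
    by (intro sum mult C prod pow) (auto simp: polys_over_def)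
  then show ?thesis by (simp only: subst_Const_Var)
qed

definition pdiff :: "'v \<Rightarrow> (('v \<Rightarrow>\<^sub>0 nat) \<Rightarrow>\<^sub>0 'c::comm_ring_1) \<Rightarrow> ('v \<Rightarrow>\<^sub>0 nat) \<Rightarrow>\<^sub>0 'c" where
  "pdiff i P = (\<Sum>m\<in>keys P. single (m - single i 1) (of_nat (lookup m i) * lookup P m))"

lemma pdiff_0 [simp]: "pdiff i 0 = 0"
  by (simp add: pdiff_def)

lemma pdiff_add: "pdiff i (P + Q) = pdiff i P + pdiff i Q"
  unfolding pdiff_def
  by (rule setsum_keys_plus_distrib) (auto simp: distrib_left Poly_Mapping.single_add)

lemma pdiff_sum: "pdiff i (sum g A) = (\<Sum>a\<in>A. pdiff i (g a))"
  by (induction A rule: infinite_finite_induct) (auto simp: pdiff_add)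

lemma pdiff_single: "pdiff i (single m c) = single (m - single i 1) (of_nat (lookup m i) * c)"
  by (simp add: pdiff_def)

lemma pdiff_Const [simp]: "pdiff i (Const c) = 0"
  by (simp add: pdiff_single)

lemma pdiff_Var: "pdiff i (Var x) = (if x = i then 1 else 0)"
  by (simp add: pdiff_single lookup_single when_def)

lemma pdiff_mult: "pdiff i (P * Q) = pdiff i P * Q + P * pdiff i Q"
proof -
  have single: "pdiff i (single m a * single n b) =
      pdiff i (single m a) * single n b + single m a * pdiff i (single n b)" for m n a b
  proof -
    have "single (m + n - single i 1) (of_nat (lookup m i) * (a * b)) =
        single (m - single i 1 + n) (of_nat (lookup m i) * (a * b))"
    proof (cases "lookup m i = 0")
      case False
      then have "m + n - single i 1 = m - single i 1 + n"
        by (intro poly_mapping_eqI) (auto simp: lookup_add lookup_minus lookup_single when_def)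
      then show ?thesis by simp
    qed simp
    moreover have "single (m + n - single i 1) (of_nat (lookup n i) * (a * b)) =
        single (m + (n - single i 1)) (of_nat (lookup n i) * (a * b))"
    proof (cases "lookup n i = 0")
      case False
      then have "m + n - single i 1 = m + (n - single i 1)"
        by (intro poly_mapping_eqI) (auto simp: lookup_add lookup_minus lookup_single when_def)
      then show ?thesis by simp
    qed simp
    ultimately have "single (m + n - single i 1) (of_nat (lookup m i + lookup n i) * (a * b)) =
        single (m - single i 1 + n) (of_nat (lookup m i) * (a * b)) +
        single (m + (n - single i 1)) (of_nat (lookup n i) * (a * b))"
      by (simp only: of_nat_add distrib_right Poly_Mapping.single_add)
    then show ?thesis
      by (simp add: pdiff_single Poly_Mapping.mult_single lookup_add mult.assoc mult.left_commute[of a])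
  qed
  define s where "s m = single m (lookup P m)" for m
  define t where "t m = single m (lookup Q m)" for m
  have P: "P = sum s (keys P)" and Q: "Q = sum t (keys Q)"
    unfolding s_def t_def by (rule poly_expand)+
  have "pdiff i (sum s (keys P) * sum t (keys Q)) =
      pdiff i (sum s (keys P)) * sum t (keys Q) + sum s (keys P) * pdiff i (sum t (keys Q))"
    by (simp add: sum_product pdiff_sum sum.distrib single[folded s_def t_def] s_def t_def single)
  then show ?thesis by (simp only: flip: P Q)
qed

lemma lookup_pdiff:
  fixes P :: "('v \<Rightarrow>\<^sub>0 nat) \<Rightarrow>\<^sub>0 'b::comm_ring_1"
  shows "lookup (pdiff i P) m = of_nat (Suc (lookup m i)) * lookup P (m + single i 1)"
proof -
  have eq: "m' = m + single i 1" if "lookup m' i \<noteq> 0" "m' - single i 1 = m" for m'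
    using that(1) unfolding that(2)[symmetric]
    by (intro poly_mapping_eqI) (auto simp: lookup_add lookup_minus lookup_single when_def)
  have shift_back: "m + single i 1 - single i 1 = m" by simp
  have "lookup (pdiff i P) m =
      (\<Sum>m'\<in>keys P. if m' - single i 1 = m then of_nat (lookup m' i) * lookup P m' else 0)"
    unfolding pdiff_def by (simp add: lookup_sum lookup_single when_def)
  also have "\<dots> = (\<Sum>m'\<in>keys P.
      if m' = m + single i 1 then of_nat (Suc (lookup m i)) * lookup P (m + single i 1) else 0)"
  proof (rule sum.cong)
    fix m'
    show "(if m' - single i 1 = m then of_nat (lookup m' i) * lookup P m' else 0) =
      (if m' = m + single i 1 then of_nat (Suc (lookup m i)) * lookup P (m + single i 1) else 0)"
    proof (cases "m' = m + single i 1")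
      case True
      then show ?thesis using shift_back by (simp add: lookup_add)
    next
      case False
      then have "of_nat (lookup m' i) = (0::'b)" if "m' - single i 1 = m"
        using eq[OF _ that] by (metis of_nat_0)
      then show ?thesis using False by simp
    qed
  qed simp
  also have "\<dots> = of_nat (Suc (lookup m i)) * lookup P (m + single i 1)"
    by (auto simp: in_keys_iff)
  finally show ?thesis .
qed

lemma pdiff_not_occurring: "(\<And>m. m \<in> keys P \<Longrightarrow> i \<notin> keys m) \<Longrightarrow> pdiff i P = 0"
  by (auto simp: pdiff_def in_keys_iff intro!: sum.neutral)

lemma pdiff_hom_polys:
  assumes K: "is_subring K" and P: "P \<in> hom_polys K X w d"
  shows "if w i \<le> d then pdiff i P \<in> hom_polys K X w (d - w i) else pdiff i P = 0"
proof -
  have key: "wdeg w m + w i = d" "keys m \<subseteq> X" if "m \<in> keys (pdiff i P)" for m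
  proof -
    have m: "m + single i 1 \<in> keys P"
      using that by (auto simp: in_keys_iff lookup_pdiff)
    then show "wdeg w m + w i = d"
      using P wdeg_add[of w m "single i 1"] by (simp add: hom_polys_def)
    have "keys m \<subseteq> keys (m + single i 1)" by (auto simp: in_keys_iff lookup_add)
    then show "keys m \<subseteq> X" using m P by (auto simp: hom_polys_def polys_over_def)
  qed
  have "lookup (pdiff i P) m \<in> K" for m
    using P unfolding lookup_pdiff hom_polys_def polys_over_def
    by (intro subringD(6)[OF K] subring_of_nat[OF K]) auto
  then have "pdiff i P \<in> polys_over K X" using key(2) by (simp add: polys_over_def)
  moreover have "pdiff i P = 0" if "\<not> w i \<le> d"
  proof -
    have "keys (pdiff i P) = {}" using key(1) that by fastforce
    then show ?thesis by simp
  qed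
  moreover have "wdeg w m = d - w i" if "m \<in> keys (pdiff i P)" for m using key(1)[OF that] by simp
  ultimately show ?thesis by (simp add: hom_polys_def)
qed

text \<open>Both sides are derivations along the substitution, so it suffices to compare them on
  constants and on variables.\<close>

lemma pdiff_chain_rule:
  fixes v :: "'a \<Rightarrow> (('a \<Rightarrow>\<^sub>0 nat) \<Rightarrow>\<^sub>0 'a::comm_ring_1) fps"
  defines "\<tau> \<equiv> subst (\<lambda>c. fps_const (Const c)) v"
  assumes "finite J" "P \<in> polys_over UNIV J"
  shows "map_fps (pdiff i) (\<tau> P) = (\<Sum>x\<in>J. \<tau> (pdiff x P) * map_fps (pdiff i) (v x))"
proof -
  let ?d = "map_fps (pdiff i)"
  have hom: "is_ring_hom (\<lambda>c. fps_const (Const c :: ('a \<Rightarrow>\<^sub>0 nat) \<Rightarrow>\<^sub>0 'a))"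
    by (rule ring_hom_comp[OF ring_hom_fps_const ring_hom_Const])
  have \<tau>: "is_ring_hom \<tau>" unfolding \<tau>_def by (rule ring_hom_subst[OF hom])
  have d_add: "?d (F + F') = ?d F + ?d F'" for F F' by (simp add: fps_eq_iff pdiff_add)
  have d_mult: "?d (F * F') = ?d F * F' + F * ?d F'" for F F'
    by (simp add: fps_eq_iff fps_mult_nth pdiff_sum pdiff_mult sum.distrib)
  show ?thesis using assms(3)
  proof (induction P rule: poly_induct)
    case (Const c)
    have "?d (\<tau> (Const c)) = 0" by (simp add: \<tau>_def subst_Const[OF hom] fps_eq_iff)
    then show ?case by (simp add: ring_hom_0[OF \<tau>])
  next
    case (Var y)
    have "(\<Sum>x\<in>J. \<tau> (pdiff x (Var y)) * ?d (v x)) = (\<Sum>x\<in>J. if x = y then ?d (v y) else 0)"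
      by (rule sum.cong) (auto simp: pdiff_Var ring_hom_0[OF \<tau>] ring_hom_1[OF \<tau>])
    then show ?case using Var assms(2) by (simp add: \<tau>_def subst_Var[OF hom])
  next
    case (add P Q)
    then show ?case
      by (simp add: ring_hom_add[OF \<tau>] pdiff_add d_add distrib_right sum.distrib)
  next
    case (mult P Q)
    have "?d (\<tau> (P * Q)) = ?d (\<tau> P) * \<tau> Q + \<tau> P * ?d (\<tau> Q)"
      by (simp add: ring_hom_mult[OF \<tau>] d_mult)
    also have "\<dots> = (\<Sum>x\<in>J. \<tau> (pdiff x (P * Q)) * ?d (v x))"
      unfolding mult
      by (simp add: pdiff_mult ring_hom_add[OF \<tau>] ring_hom_mult[OF \<tau>]
          sum_distrib_left sum_distrib_right algebra_simps flip: sum.distrib)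
    finally show ?case .
  qed
qed

section \<open>Homogeneous generators independent modulo decomposables\<close>

text \<open>The degree \<open>n\<close> part of the square of the ideal of elements of positive degree.\<close>

inductive_set decomposables :: "(nat \<Rightarrow> 'a::comm_ring_1 set) \<Rightarrow> nat \<Rightarrow> 'a set"
  for G :: "nat \<Rightarrow> 'a set" and n :: nat where
  zero: "0 \<in> decomposables G n"
| prod: "x \<in> G a \<Longrightarrow> y \<in> G b \<Longrightarrow> a > 0 \<Longrightarrow> b > 0 \<Longrightarrow> a + b = n \<Longrightarrow> x * y \<in> decomposables G n"
| add: "x \<in> decomposables G n \<Longrightarrow> y \<in> decomposables G n \<Longrightarrow> x + y \<in> decomposables G n"

lemma decomposables_sum:
  "(\<And>i. i \<in> A \<Longrightarrow> f i \<in> decomposables G n) \<Longrightarrow> sum f A \<in> decomposables G n"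
  by (induction A rule: infinite_finite_induct) (auto intro: decomposables.intros)

context graded_char_p
begin

lemma decomposables_scale:
  assumes "c \<in> K" "x \<in> decomposables G n"
  shows "c * x \<in> decomposables G n"
  using assms(2)
proof induction
  case (prod x a y b)
  then show ?case
    using decomposables.prod[of "c * x" G a y b n] scale_mem[OF assms(1)] by (simp add: mult.assoc)
qed (auto simp: distrib_left intro: decomposables.intros)

lemma decomposables_uminus: "x \<in> decomposables G n \<Longrightarrow> -x \<in> decomposables G n"
  using decomposables_scale[OF uminus_mem[OF one_mem], of x n] by simp

definition independent_mod_dec :: "nat \<Rightarrow> 'a set \<Rightarrow> bool" where
  "independent_mod_dec n B \<longleftrightarrow>
     (\<forall>T c. finite T \<longrightarrow> T \<subseteq> B \<longrightarrow> (\<forall>t\<in>T. c t \<in> K) \<longrightarrow> (\<Sum>t\<in>T. c t * t) \<in> decomposables G n \<longrightarrow>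
        (\<forall>t\<in>T. c t = 0))"

lemma independent_mod_decD:
  assumes "independent_mod_dec n B" "finite T" "T \<subseteq> B" "\<And>t. t \<in> T \<Longrightarrow> c t \<in> K"
    "(\<Sum>t\<in>T. c t * t) \<in> decomposables G n" "t \<in> T"
  shows "c t = 0"
  using assms unfolding independent_mod_dec_def by simp

lemma maximal_independent:
  "\<exists>B\<subseteq>G n. independent_mod_dec n B \<and>
     (\<forall>x\<in>G n. \<exists>T c. finite T \<and> T \<subseteq> B \<and> (\<forall>t\<in>T. c t \<in> K) \<and>
        x - (\<Sum>t\<in>T. c t * t) \<in> decomposables G n)"
proof -
  let ?A = "{B. B \<subseteq> G n \<and> independent_mod_dec n B}"
  have "\<exists>M\<in>?A. \<forall>B\<in>?A. M \<subseteq> B \<longrightarrow> B = M"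
  proof (rule subset_Zorn')
    fix C assume C: "subset.chain ?A C"
    have "independent_mod_dec n (\<Union>C)"
      unfolding independent_mod_dec_def
    proof (intro allI impI)
      fix T c
      assume T: "finite T" "T \<subseteq> \<Union>C" "\<forall>t\<in>T. c t \<in> K" "(\<Sum>t\<in>T. c t * t) \<in> decomposables G n"
      show "\<forall>t\<in>T. c t = 0"
      proof (cases "C = {}")
        case False
        obtain B where "B \<in> C" "T \<subseteq> B"
          using finite_subset_Union_chain[OF T(1,2) False C] by blast
        then have "independent_mod_dec n B" using C by (auto simp: subset.chain_def)
        then show ?thesis using independent_mod_decD[OF _ T(1) \<open>T \<subseteq> B\<close>, of n c] T(3,4) by simp
      qed (use T in auto)
    qed
    then show "\<Union>C \<in> ?A" using C by (auto simp: subset.chain_def)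
  qed
  then obtain B where "B \<in> ?A" and max': "\<forall>B'\<in>?A. B \<subseteq> B' \<longrightarrow> B' = B" ..
  then have B: "B \<subseteq> G n" "independent_mod_dec n B" by simp_all
  have max: "B' = B" if "B' \<subseteq> G n" "independent_mod_dec n B'" "B \<subseteq> B'" for B'
    using max' that by simp
  have "\<exists>T c. finite T \<and> T \<subseteq> B \<and> (\<forall>t\<in>T. c t \<in> K) \<and> x - (\<Sum>t\<in>T. c t * t) \<in> decomposables G n"
    if x: "x \<in> G n" for x
  proof (cases "x \<in> B")
    case True
    then show ?thesis
      by (intro exI[of _ "{x}"] exI[of _ "\<lambda>_. 1"]) (auto simp: one_mem decomposables.zero)
  next
    case False
    then have "\<not> independent_mod_dec n (insert x B)" using max[of "insert x B"] B(1) x by auto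
    then obtain T c where "finite T \<and> T \<subseteq> insert x B \<and> (\<forall>t\<in>T. c t \<in> K) \<and>
      (\<Sum>t\<in>T. c t * t) \<in> decomposables G n \<and> \<not> (\<forall>t\<in>T. c t = 0)"
      unfolding independent_mod_dec_def not_all not_imp by (elim exE)
    then have T: "finite T" "T \<subseteq> insert x B" "\<And>t. t \<in> T \<Longrightarrow> c t \<in> K"
      "(\<Sum>t\<in>T. c t * t) \<in> decomposables G n" and nz: "\<exists>t\<in>T. c t \<noteq> 0" by blast+
    let ?T = "T - {x}"
    have T': "finite ?T" "?T \<subseteq> B" "\<forall>t\<in>?T. c t \<in> K" using T by auto
    have cx: "x \<in> T \<and> c x \<noteq> 0"
    proof (rule ccontr)
      assume *: "\<not> (x \<in> T \<and> c x \<noteq> 0)"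
      have "(\<Sum>t\<in>T. c t * t) = (\<Sum>t\<in>?T. c t * t)"
        using * T(1) by (intro sum.mono_neutral_right) auto
      then have "(\<Sum>t\<in>?T. c t * t) \<in> decomposables G n" using T(4) by simp
      then have "\<forall>t\<in>?T. c t = 0"
        using independent_mod_decD[OF B(2) T'(1,2), of c] T'(3) by blast
      then show False using nz * by auto
    qed
    then obtain b where b: "b \<in> K" "c x * b = 1" using K_inverse T(3) by blast
    have "(\<Sum>t\<in>T. c t * t) = c x * x + (\<Sum>t\<in>?T. c t * t)"
      by (rule sum.remove) (use cx T(1) in auto)
    then have "b * (\<Sum>t\<in>T. c t * t) = (c x * b) * x + (\<Sum>t\<in>?T. (b * c t) * t)"
      by (simp add: distrib_left sum_distrib_left mult_ac)
    then have "b * (\<Sum>t\<in>T. c t * t) = x - (\<Sum>t\<in>?T. (- b * c t) * t)"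
      by (simp add: b(2) sum_negf)
    then have "x - (\<Sum>t\<in>?T. (- b * c t) * t) \<in> decomposables G n"
      using decomposables_scale[OF b(1) T(4)] by simp
    moreover have "\<forall>t\<in>?T. - b * c t \<in> K" using T'(3) scale_mem[OF uminus_mem[OF b(1)]] by simp
    ultimately show ?thesis
      using T'(1,2) by (intro exI[of _ ?T] exI[of _ "\<lambda>t. - b * c t"]) simp
  qed
  then show ?thesis using B by (intro exI[of _ B]) simp
qed

text \<open>The set \<open>X\<close> lifts a homogeneous basis of the positive part modulo decomposables. The degrees are
recorded by \<open>w\<close>, which will serve as the weights of the variables.\<close>

lemma exists_minimal_generators:
  "\<exists>X w. (\<forall>x\<in>X. w x > 0 \<and> x \<in> G (w x)) \<and> (\<forall>n>0. independent_mod_dec n {x\<in>X. w x = n}) \<and>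
     (\<forall>n>0. \<forall>x\<in>G n. \<exists>T c. finite T \<and> T \<subseteq> {x\<in>X. w x = n} \<and> (\<forall>t\<in>T. c t \<in> K) \<and>
        x - (\<Sum>t\<in>T. c t * t) \<in> decomposables G n)"
proof -
  let ?spans = "\<lambda>n B. \<forall>x\<in>G n. \<exists>T c. finite T \<and> T \<subseteq> B \<and> (\<forall>t\<in>T. c t \<in> K) \<and>
      x - (\<Sum>t\<in>T. c t * t) \<in> decomposables G n"
  have "\<forall>n. \<exists>B. B \<subseteq> G n \<and> independent_mod_dec n B \<and> ?spans n B"
    using maximal_independent by (intro allI)
  from choice[OF this] obtain B
    where *: "\<forall>n. B n \<subseteq> G n \<and> independent_mod_dec n (B n) \<and> ?spans n (B n)" ..
  have B: "B n \<subseteq> G n" "independent_mod_dec n (B n)" and span: "?spans n (B n)" for n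
    using spec[OF *, of n] by - (elim conjE, assumption)+
  have nz: "0 \<notin> B n" for n
  proof
    assume "0 \<in> B n"
    then have "(1::'a) = 0"
      using independent_mod_decD[OF B(2)[of n], of "{0}" "\<lambda>_. 1" 0]
      by (simp add: one_mem decomposables.zero)
    then show False by simp
  qed
  have unique: "m = n" if "x \<in> B m" "x \<in> B n" for x m n
    using that B(1) nz homogeneous_unique by (metis subsetD)
  define X where "X = (\<Union>n\<in>{0<..}. B n)"
  define w where "w x = (THE n. x \<in> B n)" for x
  have w: "w x = n" if "x \<in> B n" for x n
    unfolding w_def using that unique by (intro the_equality) auto
  have eq: "{x\<in>X. w x = n} = B n" if "n > 0" for n
    using that w by (auto simp: X_def)
  have "w x > 0 \<and> x \<in> G (w x)" if "x \<in> X" for x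
    using that B(1) w by (auto simp: X_def)
  then show ?thesis using eq B(2) span by (intro exI[of _ X] exI[of _ w]) simp
qed

end

section \<open>The generators are algebraically independent\<close>

locale F_data_generators = F_data +
  fixes X :: "'a set" and w :: "'a \<Rightarrow> nat"
  assumes w_pos: "x \<in> X \<Longrightarrow> w x > 0" and X_mem: "x \<in> X \<Longrightarrow> x \<in> G (w x)"
    and X_independent: "n > 0 \<Longrightarrow> independent_mod_dec n {x\<in>X. w x = n}"
    and X_span: "n > 0 \<Longrightarrow> x \<in> G n \<Longrightarrow> \<exists>T c. finite T \<and> T \<subseteq> {x\<in>X. w x = n} \<and>
      (\<forall>t\<in>T. c t \<in> K) \<and> x - (\<Sum>t\<in>T. c t * t) \<in> decomposables G n"
begin

abbreviation H where "H \<equiv> hom_polys K X w"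

lemmas graded_H = graded_family_hom_polys[OF subring_K, of X w]
lemma Const_H: "c \<in> K \<Longrightarrow> Const c \<in> H 0"
  using zero_mem by (auto simp: hom_polys_def polys_over_def lookup_single when_def)

lemma Var_H: "x \<in> X \<Longrightarrow> Var x \<in> H (w x)"
  using zero_mem one_mem by (auto simp: hom_polys_def polys_over_def lookup_single when_def)

lemma poly_value_H: "P \<in> H d \<Longrightarrow> poly_value P \<in> G d"
  by (rule poly_value_mem[where X = X and w = w]) (auto intro: X_mem)

lemma poly_value_Const: "poly_value (Const c) = c"
  by (simp add: poly_value_conv_subst subst_Const[OF ring_hom_id])

lemma poly_value_Var: "poly_value (Var x) = x"
  by (simp add: poly_value_conv_subst subst_Var[OF ring_hom_id])

lemma wdeg_pos: "keys m \<subseteq> X \<Longrightarrow> m \<noteq> 0 \<Longrightarrow> wdeg w m > 0"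
proof -
  assume X: "keys m \<subseteq> X" and "m \<noteq> 0"
  then obtain x where x: "x \<in> keys m" by fastforce
  then have "lookup m x * w x > 0" using w_pos[of x] subsetD[OF X x] by (simp add: in_keys_iff)
  also have "lookup m x * w x \<le> wdeg w m"
    unfolding wdeg_def by (rule member_le_sum) (use x in auto)
  finally show ?thesis .
qed

lemma H_0:
  assumes "P \<in> H 0"
  shows "P = Const (lookup P 0)"
proof -
  have "m = 0" if "m \<in> keys P" for m
  proof -
    have "wdeg w m = 0" "keys m \<subseteq> X"
      using assms that by (auto simp: hom_polys_def polys_over_def)
    then show ?thesis using wdeg_pos[of m] by fastforce
  qed
  then show ?thesis
    by (intro poly_mapping_eqI) (auto simp: lookup_single when_def in_keys_iff)
qed

lemma exists_lift: "x \<in> G n \<Longrightarrow> \<exists>P\<in>H n. poly_value P = x"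
proof (induction n arbitrary: x rule: less_induct)
  case (less n)
  show ?case
  proof (cases "n = 0")
    case True
    then show ?thesis using less.prems Const_H poly_value_Const by blast
  next
    case False
    then have "n > 0" by simp
    from X_span[OF this less.prems] obtain T c where "finite T \<and> T \<subseteq> {x\<in>X. w x = n} \<and>
      (\<forall>t\<in>T. c t \<in> K) \<and> x - (\<Sum>t\<in>T. c t * t) \<in> decomposables G n" by (elim exE)
    then have T: "finite T" "T \<subseteq> {x\<in>X. w x = n}" "\<And>t. t \<in> T \<Longrightarrow> c t \<in> K"
      and dec: "x - (\<Sum>t\<in>T. c t * t) \<in> decomposables G n" by simp_all
    have lift: "\<exists>P\<in>H n. poly_value P = y" if "y \<in> decomposables G n" for y
      using that
    proof induction
      case zero
      then show ?case
        using graded_familyD(2)[OF graded_H] ring_hom_0[OF ring_hom_poly_value] by blast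
    next
      case (prod x a y b)
      then obtain P Q where "P \<in> H a" "Q \<in> H b" "poly_value P = x" "poly_value Q = y"
        using less.IH[of a x] less.IH[of b y] by auto
      then have "P * Q \<in> H n" "poly_value (P * Q) = x * y"
        using graded_familyD(4)[OF graded_H] prod.hyps(5) ring_hom_mult[OF ring_hom_poly_value]
        by blast+
      then show ?case by blast
    next
      case (add x y)
      then obtain P Q where "P \<in> H n" "Q \<in> H n" "poly_value P = x" "poly_value Q = y" by blast
      then have "P + Q \<in> H n" "poly_value (P + Q) = x + y"
        using graded_familyD(3)[OF graded_H] ring_hom_add[OF ring_hom_poly_value] by blast+
      then show ?case by blast
    qed
    define Q where "Q = (\<Sum>t\<in>T. Const (c t) * Var t)"
    have "Const (c t) * Var t \<in> H n" if "t \<in> T" for t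
      using graded_familyD(4)[OF graded_H Const_H[OF T(3)[OF that]] Var_H[of t]] T(2) that by auto
    then have Q: "Q \<in> H n" unfolding Q_def by (rule graded_family_sum[OF graded_H])
    have vQ: "poly_value Q = (\<Sum>t\<in>T. c t * t)"
      unfolding Q_def ring_hom_sum[OF ring_hom_poly_value] ring_hom_mult[OF ring_hom_poly_value]
        poly_value_Const poly_value_Var ..
    obtain P where P: "P \<in> H n" "poly_value P = x - (\<Sum>t\<in>T. c t * t)" using lift[OF dec] by blast
    have "P + Q \<in> H n" "poly_value (P + Q) = x"
      using graded_familyD(3)[OF graded_H] P Q
      by (auto simp: ring_hom_add[OF ring_hom_poly_value] vQ)
    then show ?thesis by blast
  qed
qed

lemma monom_value_mem:
  "keys m \<subseteq> X \<Longrightarrow> monom_value (\<lambda>x. x) m \<in> G (wdeg w m)"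
  by (rule monom_value_graded[OF graded_G]) (auto intro: X_mem)

text \<open>A variable of weight \<open>d\<close> can occur in a monomial of weighted degree \<open>d\<close> only alone; all other
monomials take decomposable values, so the linear part of a relation is a relation modulo
decomposables.\<close>

lemma relation_no_linear_term:
  assumes f: "f \<in> H d" "poly_value f = 0" and i: "i \<in> X" "w i = d"
  shows "lookup f (single i 1) = 0"
proof (rule ccontr)
  assume nz: "lookup f (single i 1) \<noteq> 0"
  have d: "d > 0" using w_pos i by blast
  define T where "T = {t\<in>X. w t = d \<and> single t 1 \<in> keys f}"
  let ?L = "(\<lambda>t. single t (1::nat)) ` T" and ?v = "\<lambda>m. lookup f m * monom_value (\<lambda>x. x) m"
  have inj: "inj_on (\<lambda>t. single t (1::nat)) T"
  proof (rule inj_onI)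
    fix s t assume "single s (1::nat) = single t 1"
    then have "keys (single s (1::nat)) = keys (single t (1::nat))" by simp
    then show "s = t" by simp
  qed
  have L: "?L \<subseteq> keys f" by (auto simp: T_def)
  have T: "finite T" by (rule finite_imageD[OF finite_subset[OF L] inj]) simp
  have "?v m \<in> decomposables G d" if m: "m \<in> keys f - ?L" for m
  proof -
    have m': "wdeg w m = d" "keys m \<subseteq> X" "lookup f m \<in> K"
      using f(1) m by (auto simp: hom_polys_def polys_over_def)
    then have "keys m \<noteq> {}" using d by (auto simp: wdeg_def)
    then obtain x where x: "x \<in> keys m" by blast
    define n where "n = m - single x 1"
    have mn: "m = n + single x 1"
      using x by (intro poly_mapping_eqI)
        (auto simp: n_def lookup_add lookup_minus lookup_single when_def in_keys_iff)
    have xX: "x \<in> X" using x m'(2) by blast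
    have nX: "keys n \<subseteq> X"
      using m'(2) by (auto simp: n_def in_keys_iff lookup_minus subset_iff)
    have deg: "wdeg w n + w x = d" using m'(1) unfolding mn wdeg_add by simp
    have "wdeg w n \<noteq> 0"
    proof
      assume *: "wdeg w n = 0"
      then have "n = 0" using wdeg_pos[OF nX] by fastforce
      then have "m = single x 1" using mn by simp
      moreover have "w x = d" using deg * by simp
      ultimately show False using m xX by (auto simp: T_def)
    qed
    then have "monom_value (\<lambda>x. x) n * x \<in> decomposables G d"
      using deg monom_value_mem[OF nX] X_mem[OF xX] w_pos[OF xX]
      by (intro decomposables.prod[of _ G "wdeg w n" _ "w x"]) auto
    then have "monom_value (\<lambda>x. x) m \<in> decomposables G d"
      unfolding mn monom_value_add by simp
    then show ?thesis by (rule decomposables_scale[OF m'(3)])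
  qed
  then have R: "(\<Sum>m\<in>keys f - ?L. ?v m) \<in> decomposables G d" by (rule decomposables_sum)
  have "0 = (\<Sum>m\<in>keys f. ?v m)" using f(2) by (simp add: poly_value_conv_subst subst_def)
  also have "\<dots> = (\<Sum>m\<in>keys f - ?L. ?v m) + (\<Sum>m\<in>?L. ?v m)"
    by (rule sum.subset_diff[OF L]) simp
  also have "(\<Sum>m\<in>?L. ?v m) = (\<Sum>t\<in>T. lookup f (single t 1) * t)"
    by (subst sum.reindex[OF inj]) simp
  finally have "(\<Sum>t\<in>T. lookup f (single t 1) * t) = - (\<Sum>m\<in>keys f - ?L. ?v m)"
    by (simp add: eq_neg_iff_add_eq_0 add.commute)
  then have dec: "(\<Sum>t\<in>T. lookup f (single t 1) * t) \<in> decomposables G d"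
    using decomposables_uminus[OF R] by simp
  have coeff: "lookup f (single t 1) \<in> K" for t
    using f(1) by (simp add: hom_polys_def polys_over_def)
  have "T \<subseteq> {x\<in>X. w x = d}" "i \<in> T" using i nz by (auto simp: T_def in_keys_iff)
  then show False using independent_mod_decD[OF X_independent[OF d] T _ coeff dec] nz by blast
qed

text \<open>A lift of \<open>\<delta>\<close> to the polynomial ring, homogeneous of the same degree \<open>- s\<close>. Choosing lifts of
  the \<open>\<delta>\<^sub>l x\<close> for the variables \<open>x\<close> is enough, since a homomorphism into power series may be prescribed
  there.\<close>

lemma exists_hasse_lift:
  assumes \<delta>: "\<delta> \<in> \<D>"
  obtains v s where "s > 0" "\<And>x. x \<in> X \<Longrightarrow> v x \<in> hom_series s H (w x)"
    "\<And>x. x \<in> X \<Longrightarrow> fps_nth (v x) 0 = Var x" "\<And>x. x \<in> X \<Longrightarrow> map_fps poly_value (v x) = hasse_series \<delta> x"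
proof -
  obtain s where s: "s > 0" "\<And>x k. x \<in> G k \<Longrightarrow> hasse_series \<delta> x \<in> hom_series s G k"
    using hasse_degree[OF \<delta>] by metis
  define lift where "lift n x = (SOME P. P \<in> H n \<and> poly_value P = x)" for n x
  have lift: "lift n x \<in> H n" "poly_value (lift n x) = x" if "x \<in> G n" for n x
    using exists_lift[OF that] someI_ex[of "\<lambda>P. P \<in> H n \<and> poly_value P = x"]
    unfolding lift_def by blast+
  define v where "v x = Abs_fps (\<lambda>l. if l = 0 then Var x else if l * s \<le> w x
      then lift (w x - l * s) (\<delta> l x) else 0)" for x
  show ?thesis
  proof (rule that[OF s(1)])
    fix x assume x: "x \<in> X"
    have h: "hasse_series \<delta> x \<in> hom_series s G (w x)" by (rule s(2)[OF X_mem[OF x]])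
    show "v x \<in> hom_series s H (w x)"
      using h Var_H[OF x] lift(1) by (auto simp: hom_series_iff v_def)
    show "fps_nth (v x) 0 = Var x" by (simp add: v_def)
    have "\<delta> 0 x = x" using hasse[OF \<delta>] by (simp add: hasse_derivation_def)
    then show "map_fps poly_value (v x) = hasse_series \<delta> x"
      using h lift(2) by (auto simp: fps_eq_iff hom_series_iff v_def poly_value_Var
          ring_hom_0[OF ring_hom_poly_value])
  qed
qed

text \<open>For a relation \<open>f\<close> of least degree, the lifted derivatives of \<open>f\<close> are relations of lower degree, hence
zero as polynomials. Differentiating this formal identity with respect to the variable \<open>i\<close> by the
chain rule expresses the derivatives of \<open>\<partial>f/\<partial>i\<close> through the \<open>\<partial>f/\<partial>x\<close> with \<open>x\<close> of larger weight; for
\<open>i\<close> of top weight nothing is left.\<close>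

lemma relation_top_derivative:
  assumes inj: "\<And>n P. n < d \<Longrightarrow> P \<in> H n \<Longrightarrow> poly_value P = 0 \<Longrightarrow> P = 0"
    and f: "f \<in> H d" "poly_value f = 0"
    and i: "i \<in> X" "\<And>x. x \<in> X \<Longrightarrow> w x > w i \<Longrightarrow> pdiff x f = 0"
    and \<delta>: "\<delta> \<in> \<D>" and m: "m > 0"
  shows "\<delta> m (poly_value (pdiff i f)) = 0"
proof -
  obtain v s where s: "s > 0" and v: "\<And>x. x \<in> X \<Longrightarrow> v x \<in> hom_series s H (w x)"
    and v0: "\<And>x. x \<in> X \<Longrightarrow> fps_nth (v x) 0 = Var x"
    and v_value: "\<And>x. x \<in> X \<Longrightarrow> map_fps poly_value (v x) = hasse_series \<delta> x"
    using exists_hasse_lift[OF \<delta>] by metis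
  define \<tau> where "\<tau> = subst (\<lambda>c. fps_const (Const c)) v"
  have hom: "is_ring_hom (\<lambda>c. fps_const (Const c :: ('a \<Rightarrow>\<^sub>0 nat) \<Rightarrow>\<^sub>0 'a))"
    by (rule ring_hom_comp[OF ring_hom_fps_const ring_hom_Const])
  have \<tau>_value: "poly_value (fps_nth (\<tau> P) k) = \<delta> k (poly_value P)"
    if P: "P \<in> polys_over K X" for P k
  proof -
    have "map_fps poly_value (\<tau> P) =
        subst (\<lambda>c. map_fps poly_value (fps_const (Const c))) (\<lambda>x. map_fps poly_value (v x)) P"
      unfolding \<tau>_def by (rule hom_subst[OF ring_hom_map_fps[OF ring_hom_poly_value]])
    also have "\<dots> = subst (\<lambda>c. hasse_series \<delta> c) (\<lambda>x. hasse_series \<delta> x) P"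
      using P
    proof (rule subst_cong)
      fix a assume "a \<in> K"
      then show "map_fps poly_value (fps_const (Const a)) = hasse_series \<delta> a"
        by (simp add: hasse_K[OF \<delta>] fps_eq_iff poly_value_Const ring_hom_0[OF ring_hom_poly_value])
    qed (rule v_value)
    also have "\<dots> = hasse_series \<delta> (poly_value P)"
      by (simp add: poly_value_conv_subst hom_subst[OF hom_hasse[OF \<delta>]])
    finally show ?thesis by (simp add: fps_eq_iff)
  qed
  have fK: "f \<in> polys_over K X" using f(1) by (simp add: hom_polys_def)
  have "\<tau> f \<in> hom_series s H d"
    unfolding \<tau>_def
    by (rule subst_graded[OF graded_family_hom_series[OF graded_H] f(1)])
       (auto intro: fps_const_hom_series graded_H Const_H v)
  then have mem: "m * s \<le> d \<Longrightarrow> fps_nth (\<tau> f) m \<in> H (d - m * s)"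
    "d < m * s \<Longrightarrow> fps_nth (\<tau> f) m = 0"
    by (auto simp: hom_series_iff)
  have "poly_value (fps_nth (\<tau> f) m) = 0"
    by (simp add: \<tau>_value[OF fK] f(2) hasse_zero[OF \<delta>])
  moreover have "m * s > 0" using m s by simp
  then have "d - m * s < d" if "m * s \<le> d" using that by linarith
  ultimately have \<tau>f: "fps_nth (\<tau> f) m = 0"
    using inj[OF _ mem(1)] mem(2) by (cases "m * s \<le> d") auto
  define J where "J = insert i (\<Union>n\<in>keys f. keys n)"
  have J: "finite J" "J \<subseteq> X" "f \<in> polys_over UNIV J"
    using fK i(1) by (auto simp: J_def polys_over_def)
  \<comment> \<open>In degree \<open>m\<close> only the term \<open>x = i\<close>, \<open>a = m\<close> of the chain rule survives: for \<open>a < m\<close> the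
    polynomial \<open>fps_nth (v x) (m - a)\<close> has degree less than \<open>w x \<le> w i\<close>, so it cannot involve
    the variable \<open>i\<close>.\<close>
  have summand: "fps_nth (\<tau> (pdiff x f)) a * pdiff i (fps_nth (v x) (m - a)) =
      (if a = m then if x = i then fps_nth (\<tau> (pdiff i f)) m else 0 else 0)"
    if x: "x \<in> J" and a: "a \<le> m" for x a
  proof (cases "a = m")
    case True
    then show ?thesis using v0[of x] J(2) x by (auto simp: pdiff_Var)
  next
    case False
    show ?thesis
    proof (cases "w x \<le> w i")
      case True
      have "pdiff i (fps_nth (v x) (m - a)) = 0"
      proof (cases "(m - a) * s \<le> w x")
        case True
        then have "fps_nth (v x) (m - a) \<in> H (w x - (m - a) * s)"
          using v[of x] x J(2) by (auto simp: hom_series_iff)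
        moreover have "0 < (m - a) * s" using False a s by simp
        then have "\<not> w i \<le> w x - (m - a) * s"
          using \<open>w x \<le> w i\<close> True by linarith
        ultimately show ?thesis using pdiff_hom_polys[OF subring_K] by metis
      next
        case False
        then have "fps_nth (v x) (m - a) = 0" using v[of x] x J(2) by (auto simp: hom_series_iff)
        then show ?thesis by simp
      qed
      then show ?thesis using False by simp
    next
      case 2: False
      then have "pdiff x f = 0" using i(2) x J(2) by auto
      then have "\<tau> (pdiff x f) = 0" by (simp add: \<tau>_def)
      then show ?thesis using False by simp
    qed
  qed
  have "0 = fps_nth (map_fps (pdiff i) (\<tau> f)) m" by (simp add: \<tau>f)
  also have "\<dots> = (\<Sum>x\<in>J. \<Sum>a=0..m. fps_nth (\<tau> (pdiff x f)) a * pdiff i (fps_nth (v x) (m - a)))"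
    unfolding \<tau>_def pdiff_chain_rule[OF J(1,3)] by (simp add: fps_sum_nth fps_mult_nth)
  also have "\<dots> = (\<Sum>x\<in>J. \<Sum>a=0..m.
      if a = m then if x = i then fps_nth (\<tau> (pdiff i f)) m else 0 else 0)"
    by (intro sum.cong refl) (use summand in auto)
  also have "\<dots> = fps_nth (\<tau> (pdiff i f)) m"
    using J(1) by (simp add: J_def)
  finally have "fps_nth (\<tau> (pdiff i f)) m = 0" by simp
  moreover have "pdiff i f \<in> polys_over K X"
    using pdiff_hom_polys[OF subring_K f(1), of i] subringD(1)[OF subring_polys_over[OF subring_K]]
    by (auto simp: hom_polys_def split: if_splits)
  ultimately show ?thesis using \<tau>_value[of "pdiff i f" m] by (simp add: ring_hom_0[OF ring_hom_poly_value])
qed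

text \<open>Take \<open>i\<close> of top weight with \<open>\<partial>f/\<partial>i \<noteq> 0\<close>. The value of \<open>\<partial>f/\<partial>i\<close> is killed by all derivations, so it
vanishes unless \<open>\<partial>f/\<partial>i\<close> has degree \<open>0\<close>. In the first case \<open>\<partial>f/\<partial>i\<close> is a relation of lower degree,
in the second \<open>i\<close> occurs linearly in \<open>f\<close>.\<close>

lemma relation_derivatives_zero:
  assumes inj: "\<And>n P. n < d \<Longrightarrow> P \<in> H n \<Longrightarrow> poly_value P = 0 \<Longrightarrow> P = 0"
    and f: "f \<in> H d" "poly_value f = 0" and x: "x \<in> X"
  shows "pdiff x f = 0"
proof (rule ccontr)
  assume nz: "pdiff x f \<noteq> 0"
  let ?N = "{x\<in>X. pdiff x f \<noteq> 0}"
  have "?N \<subseteq> (\<Union>n\<in>keys f. keys n)" using pdiff_not_occurring by force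
  then have fin: "finite ?N" by (rule finite_subset) simp
  have "Max (w ` ?N) \<in> w ` ?N" using fin nz x by (intro Max_in) auto
  then obtain i where i: "i \<in> ?N" "w i = Max (w ` ?N)" by auto
  have top: "pdiff y f = 0" if "y \<in> X" "w y > w i" for y
    using that i(2) Max_ge[OF finite_imageI[OF fin], of "w y" w] by fastforce
  have deg: "w i \<le> d" "pdiff i f \<in> H (d - w i)"
    using pdiff_hom_polys[OF subring_K f(1), of i] i(1) by (auto split: if_splits)
  show False
  proof (cases "w i = d")
    case True
    have "pdiff i f = Const (lookup (pdiff i f) 0)" using H_0 deg(2) True by simp
    then show False
      using i(1) relation_no_linear_term[OF f _ True] by (simp add: lookup_pdiff)
  next
    case False
    have "poly_value (pdiff i f) = 0"
      using constants[OF poly_value_H[OF deg(2)]] relation_top_derivative[OF inj f _ top] i(1)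
        False deg(1) by auto
    then have "pdiff i f = 0" using inj[OF _ deg(2)] w_pos[of i] i(1) deg(1) by auto
    then show False using i(1) by simp
  qed
qed

text \<open>A relation of least degree has zero partial derivatives, so its exponents are divisible by \<open>p\<close> and it
reads \<open>\<Sum>\<^sub>n c\<^sub>n y\<^sub>n\<^sup>p = 0\<close> with \<open>y\<^sub>n\<close> the value of a monomial. Linear disjointness turns it into
a linear relation between the \<open>y\<^sub>n\<close>, whose degree is smaller.\<close>

lemma no_relation: "f \<in> H d \<Longrightarrow> poly_value f = 0 \<Longrightarrow> f = 0"
proof (induction d arbitrary: f rule: less_induct)
  case (less d)
  show ?case
  proof (rule ccontr)
    assume nz: "f \<noteq> 0"
    have d: "d > 0"
    proof (rule ccontr)
      assume "\<not> d > 0"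
      then show False using H_0[of f] less.prems nz poly_value_Const
        by (metis gr0I single_zero)
    qed
    have dvd: "p dvd lookup n x" if n: "n \<in> keys f" for n x
    proof (rule ccontr)
      assume ndvd: "\<not> p dvd lookup n x"
      then have pos: "lookup n x > 0" by (metis dvd_0_right gr0I)
      have nX: "keys n \<subseteq> X" "lookup f n \<in> K"
        using less.prems(1) n by (auto simp: hom_polys_def polys_over_def)
      have x: "x \<in> X" using nX pos by (auto simp: in_keys_iff)
      have eq: "n - single x 1 + single x 1 = n"
        using pos by (intro poly_mapping_eqI)
          (auto simp: lookup_add lookup_minus lookup_single when_def)
      have "pdiff x f = 0" by (rule relation_derivatives_zero[OF less.IH less.prems x])
      then have "of_nat (lookup n x) * lookup f n = 0"
        using lookup_pdiff[of x f "n - single x 1"] pos unfolding eq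
        by (simp add: lookup_minus)
      moreover have "of_nat (lookup n x) \<noteq> (0::'a)"
        using ndvd of_nat_eq_0_iff_char_dvd[where 'a = 'a] char_p by auto
      ultimately have "lookup f n = 0"
        using K_no_zero_div subring_of_nat[OF subring_K] by blast
      then show False using n by (simp add: in_keys_iff)
    qed
    define r where "r n = Poly_Mapping.map (\<lambda>k. k div p) n" for n :: "'a \<Rightarrow>\<^sub>0 nat"
    have lookup_r: "lookup (r n) x = lookup n x div p" for n x
      by (simp add: r_def Poly_Mapping.map.rep_eq when_def)
    have lookup_n: "lookup n x = p * lookup (r n) x" if "n \<in> keys f" for n x
      using dvd[OF that] by (simp add: lookup_r)
    have keys_r: "keys (r n) = keys n" if "n \<in> keys f" for n
      using lookup_n[OF that] p_pos by (auto simp: in_keys_iff)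
    have inj: "inj_on r (keys f)"
      by (rule inj_onI, rule poly_mapping_eqI) (simp add: lookup_n)
    have key: "keys n \<subseteq> X" "wdeg w n = d" if "n \<in> keys f" for n
      using that less.prems(1) by (auto simp: hom_polys_def polys_over_def)
    have wdeg_r: "p * wdeg w (r n) = d" if "n \<in> keys f" for n
      using key(2)[OF that] keys_r[OF that] lookup_n[OF that]
      by (simp add: wdeg_def sum_distrib_left mult.assoc)
    let ?y = "\<lambda>n. monom_value (\<lambda>x::'a. x) (r n)"
    have value_n: "monom_value (\<lambda>x. x) n = ?y n ^ p" if "n \<in> keys f" for n
      using keys_r[OF that] lookup_n[OF that]
      by (simp add: monom_value_def prod_power_distrib mult.commute flip: power_mult)
    have y: "?y n \<in> G (d div p)" if "n \<in> keys f" for n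
      using monom_value_mem[of "r n"] key(1)[OF that] keys_r[OF that] wdeg_r[OF that] p_pos
      by (metis nonzero_mult_div_cancel_left not_gr0)
    have "(\<Sum>n\<in>keys f. lookup f n * ?y n ^ p) = poly_value f"
      by (simp add: poly_value_conv_subst subst_def value_n)
    then have rel: "(\<Sum>n\<in>keys f. lookup f n * ?y n ^ p) = 0" using less.prems(2) by simp
    have coeff: "lookup f n \<in> K" for n
      using less.prems(1) by (simp add: hom_polys_def polys_over_def)
    have "\<exists>n\<in>keys f. lookup f n \<noteq> 0"
      using nz by (metis in_keys_iff lookup_zero poly_mapping_eqI)
    from p_linear_disjoint[OF finite_keys coeff y rel this] obtain l where
      l: "\<And>n. l n \<in> K" "\<exists>n\<in>keys f. l n \<noteq> 0" "(\<Sum>n\<in>keys f. l n * ?y n) = 0"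
      by blast
    define g where "g = (\<Sum>n\<in>keys f. single (r n) (l n))"
    have "single (r n) (l n) \<in> H (d div p)" if "n \<in> keys f" for n
      using key(1)[OF that] keys_r[OF that] wdeg_r[OF that] p_pos l(1) zero_mem
      by (auto simp: hom_polys_def polys_over_def lookup_single when_def)
    then have "g \<in> H (d div p)" unfolding g_def by (rule graded_family_sum[OF graded_H])
    moreover have "poly_value g = 0"
      unfolding g_def ring_hom_sum[OF ring_hom_poly_value] using l(3)
      by (simp add: poly_value_conv_subst subst_single)
    moreover have "d div p < d" using d p_gt_1 by simp
    ultimately have "g = 0" using less.IH by blast
    obtain n where n: "n \<in> keys f" "l n \<noteq> 0" using l(2) by blast
    have "lookup g (r n) = (\<Sum>n'\<in>keys f. if n' = n then l n else 0)"
      unfolding g_def lookup_sum lookup_single when_def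
      by (rule sum.cong) (use inj n(1) in \<open>auto dest: inj_onD\<close>)
    then have "lookup g (r n) = l n" using n(1) by simp
    then show False using \<open>g = 0\<close> n(2) by simp
  qed
qed

lemma X_algebraically_independent: "algebraically_independent K X"
  unfolding algebraically_independent_def
proof (intro ballI impI)
  fix P assume P: "P \<in> polys_over K X" "poly_value P = 0"
  have "hom_part w n P = 0" for n
    using no_relation[OF hom_part_mem[OF subring_K P(1)]] component_poly_value[OF P(1) X_mem] P(2)
    by (simp add: component_0)
  then show "P = 0" by (subst sum_hom_parts[of P w]) simp
qed

lemma X_generates: "generates_algebra K X"
proof -
  let ?S = "is_subring hull (K \<union> X)"
  have S: "is_subring ?S"
    by (rule hull_in) (auto simp: is_subring_def)
  have incl: "K \<subseteq> ?S" "X \<subseteq> ?S" using hull_subset[of "K \<union> X" is_subring] by auto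
  have poly_value_in: "poly_value P \<in> ?S" if "P \<in> polys_over K X" for P
    unfolding poly_value_def
  proof (intro subring_sum[OF S] subringD(6)[OF S] subring_prod[OF S] subring_power[OF S])
    show "lookup P m \<in> ?S" for m using that incl(1) by (auto simp: polys_over_def)
    show "x \<in> ?S" if "m \<in> keys P" "x \<in> keys m" for m x
      using \<open>P \<in> polys_over K X\<close> that incl(2) unfolding polys_over_def by blast
  qed
  have "?S = UNIV"
  proof (rule UNIV_eq_I[symmetric], subst sum_component, rule subring_sum[OF S])
    fix x n
    show "component x n \<in> ?S"
      using exists_lift[OF component_mem[of x n]] poly_value_in
      by (metis (no_types, lifting) hom_polys_def mem_Collect_eq)
  qed
  then show ?thesis by (simp only: generates_algebra_def)
qed

end

lemma (in F_data) is_polynomial_ring: "is_polynomial_ring G"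
proof -
  from exists_minimal_generators obtain X w
    where gens: "(\<forall>x\<in>X. w x > 0 \<and> x \<in> G (w x)) \<and>
      (\<forall>n>0. independent_mod_dec n {x\<in>X. w x = n}) \<and>
      (\<forall>n>0. \<forall>x\<in>G n. \<exists>T c. finite T \<and> T \<subseteq> {x\<in>X. w x = n} \<and> (\<forall>t\<in>T. c t \<in> K) \<and>
        x - (\<Sum>t\<in>T. c t * t) \<in> decomposables G n)" by (elim exE)
  interpret F_data_generators G p \<phi> \<sigma> \<D> X w
    by unfold_locales (use gens in simp_all)
  show ?thesis
    unfolding is_polynomial_ring_def
    by (intro exI[of _ X] conjI ballI X_algebraically_independent X_generates) (use w_pos X_mem in blast)
qed

section \<open>Coordinates on a polynomial ring\<close>

locale graded_polynomial_ring = graded_char_p +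
  fixes X :: "'a set" and w :: "'a \<Rightarrow> nat"
  assumes w_pos: "x \<in> X \<Longrightarrow> w x > 0" and X_mem: "x \<in> X \<Longrightarrow> x \<in> G (w x)"
    and independent: "algebraically_independent K X" and generates: "generates_algebra K X"
begin

lemmas subring_polys = subring_polys_over[OF subring_K, of X]
lemma poly_value_inj:
  assumes "P \<in> polys_over K X" "Q \<in> polys_over K X" "poly_value P = poly_value Q"
  shows "P = Q"
proof -
  have "P - Q \<in> polys_over K X" by (rule subringD(3)[OF subring_polys assms(1,2)])
  moreover have "poly_value (P - Q) = 0" using assms(3) by (simp add: ring_hom_diff[OF ring_hom_poly_value])
  ultimately have "P - Q = 0" using independent unfolding algebraically_independent_def by blast
  then show ?thesis by simp
qed

lemma single_polys: "a \<in> K \<Longrightarrow> keys m \<subseteq> X \<Longrightarrow> single m a \<in> polys_over K X"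
  using zero_mem by (auto simp: polys_over_def lookup_single when_def)

lemma poly_value_single: "poly_value (single m a) = a * monom_value (\<lambda>x. x) m"
  by (simp add: poly_value_conv_subst subst_single)

lemma poly_value_surj: "\<exists>P\<in>polys_over K X. poly_value P = x"
proof -
  let ?S = "poly_value ` polys_over K X"
  have "is_subring ?S"
    unfolding is_subring_def
  proof (intro conjI ballI)
    show "1 \<in> ?S"
      using subringD(2)[OF subring_polys] ring_hom_1[OF ring_hom_poly_value] by (metis imageI)
    fix a b assume "a \<in> ?S" "b \<in> ?S"
    then obtain P Q where "P \<in> polys_over K X" "Q \<in> polys_over K X" "a = poly_value P" "b = poly_value Q"
      by blast
    then show "a - b \<in> ?S" "a * b \<in> ?S"
      using subringD(3,6)[OF subring_polys, of P Q]
      by (auto simp flip: ring_hom_diff[OF ring_hom_poly_value] ring_hom_mult[OF ring_hom_poly_value])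
  qed
  moreover have "K \<union> X \<subseteq> ?S"
  proof
    fix x assume "x \<in> K \<union> X"
    then show "x \<in> ?S"
    proof
      assume "x \<in> K"
      then have "Const x \<in> polys_over K X" "poly_value (Const x) = x"
        by (simp_all add: single_polys poly_value_single)
      then show ?thesis by (metis imageI)
    next
      assume "x \<in> X"
      then have "Var x \<in> polys_over K X" "poly_value (Var x) = x"
        by (simp_all add: single_polys poly_value_single one_mem)
      then show ?thesis by (metis imageI)
    qed
  qed
  ultimately have "is_subring hull (K \<union> X) \<subseteq> ?S" by (intro hull_minimal)
  then have "x \<in> ?S" using generates by (auto simp: generates_algebra_def)
  then show ?thesis by blast
qed

definition rep :: "'a \<Rightarrow> ('a \<Rightarrow>\<^sub>0 nat) \<Rightarrow>\<^sub>0 'a" where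
  "rep x = (SOME P. P \<in> polys_over K X \<and> poly_value P = x)"

lemma rep_polys: "rep x \<in> polys_over K X" and poly_value_rep: "poly_value (rep x) = x"
  using someI_ex[of "\<lambda>P. P \<in> polys_over K X \<and> poly_value P = x"] poly_value_surj[of x]
  unfolding rep_def by blast+

lemma rep_poly_value: "P \<in> polys_over K X \<Longrightarrow> rep (poly_value P) = P"
  by (rule poly_value_inj) (simp_all add: rep_polys poly_value_rep)

lemma ring_hom_rep: "is_ring_hom rep"
proof (rule is_ring_homI)
  note [simp] = ring_hom_1[OF ring_hom_poly_value] ring_hom_add[OF ring_hom_poly_value]
    ring_hom_mult[OF ring_hom_poly_value] poly_value_rep
  show "rep 1 = 1" using rep_poly_value[OF subringD(2)[OF subring_polys]] by simp
  show "rep (x + y) = rep x + rep y" for x y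
    using rep_poly_value[OF subringD(5)[OF subring_polys rep_polys rep_polys], of x y] by simp
  show "rep (x * y) = rep x * rep y" for x y
    using rep_poly_value[OF subringD(6)[OF subring_polys rep_polys rep_polys], of x y] by simp
qed

lemma rep_K: "a \<in> K \<Longrightarrow> rep a = Const a"
  using rep_poly_value[of "Const a"] by (simp add: single_polys poly_value_single)

lemma rep_X: "x \<in> X \<Longrightarrow> rep x = Var x"
  using rep_poly_value[of "Var x"] by (simp add: single_polys poly_value_single one_mem)

text \<open>The universal property: a homomorphism is determined by, and can be prescribed on, the
  coefficients and the variables.\<close>

definition extend :: "('a \<Rightarrow> 'b) \<Rightarrow> ('a \<Rightarrow> 'b) \<Rightarrow> 'a \<Rightarrow> 'b::comm_ring_1" where
  "extend c v x = subst c v (rep x)"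

lemma ring_hom_extend: "is_ring_hom c \<Longrightarrow> is_ring_hom (extend c v)"
  unfolding extend_def by (rule ring_hom_comp[OF ring_hom_subst ring_hom_rep])

lemma extend_K: "is_ring_hom c \<Longrightarrow> a \<in> K \<Longrightarrow> extend c v a = c a"
  by (simp add: extend_def rep_K subst_Const)

lemma extend_X: "is_ring_hom c \<Longrightarrow> x \<in> X \<Longrightarrow> extend c v x = v x"
  using subst_Var[of c v x] by (simp add: extend_def rep_X)

lemma hom_eqI:
  assumes f: "is_ring_hom f" and g: "is_ring_hom g"
    and "\<And>a. a \<in> K \<Longrightarrow> f a = g a" "\<And>x. x \<in> X \<Longrightarrow> f x = g x"
  shows "f = g"
proof
  fix r
  have expand: "h r = subst h h (rep r)" if "is_ring_hom h" for h :: "'a \<Rightarrow> 'b"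
    using hom_subst[OF that, of "\<lambda>c. c" "\<lambda>x. x" "rep r"] poly_value_rep[of r]
    by (simp add: poly_value_conv_subst)
  show "f r = g r"
    unfolding expand[OF f] expand[OF g] by (rule subst_cong[OF rep_polys]) (use assms in auto)
qed

lemma rep_homogeneous:
  assumes x: "x \<in> G n"
  shows "rep x \<in> hom_polys K X w n"
proof -
  have "wdeg w m = n" if m: "m \<in> keys (rep x)" for m
  proof (rule ccontr)
    assume "wdeg w m \<noteq> n"
    then have "component (poly_value (rep x)) (wdeg w m) = 0"
      using component_homogeneous[OF x] by (simp add: poly_value_rep)
    then have "poly_value (hom_part w (wdeg w m) (rep x)) = 0"
      using component_poly_value[OF rep_polys X_mem] by simp
    then have "hom_part w (wdeg w m) (rep x) = 0"
      using independent hom_part_mem[OF subring_K rep_polys]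
      by (simp add: algebraically_independent_def hom_polys_def)
    then have "lookup (rep x) m = 0" using lookup_hom_part[of w "wdeg w m" "rep x" m] by simp
    then show False using m by (simp add: in_keys_iff)
  qed
  then show ?thesis using rep_polys by (simp add: hom_polys_def)
qed

lemma extend_graded:
  assumes "graded_family H" "\<And>a. a \<in> K \<Longrightarrow> c a \<in> H 0" "\<And>x. x \<in> X \<Longrightarrow> v x \<in> H (w x)" "x \<in> G n"
  shows "extend c v x \<in> H n"
  unfolding extend_def by (rule subst_graded[OF assms(1) rep_homogeneous[OF assms(4)]]) (use assms in auto)

abbreviation monomial :: "('a \<Rightarrow>\<^sub>0 nat) \<Rightarrow> 'a" where "monomial \<equiv> monom_value (\<lambda>x. x)"
abbreviation coeff :: "'a \<Rightarrow> ('a \<Rightarrow>\<^sub>0 nat) \<Rightarrow> 'a" where "coeff x \<equiv> lookup (rep x)"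

lemma coeff_K: "coeff x m \<in> K" and coeff_keys: "m \<in> keys (rep x) \<Longrightarrow> keys m \<subseteq> X"
  using rep_polys[of x] by (auto simp: polys_over_def)

lemma expansion: "x = (\<Sum>m\<in>keys (rep x). coeff x m * monomial m)"
  using poly_value_rep[of x] by (simp add: poly_value_conv_subst subst_def)

lemma rep_sum_monomials:
  assumes "\<And>i. i \<in> A \<Longrightarrow> a i \<in> K" "\<And>i. i \<in> A \<Longrightarrow> keys (n i) \<subseteq> X"
  shows "rep (\<Sum>i\<in>A. a i * monomial (n i)) = (\<Sum>i\<in>A. single (n i) (a i))"
proof -
  have "(\<Sum>i\<in>A. single (n i) (a i)) \<in> polys_over K X"
    by (rule subring_sum[OF subring_polys single_polys]) (use assms in auto)
  from rep_poly_value[OF this] show ?thesis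
    by (simp add: ring_hom_sum[OF ring_hom_poly_value] poly_value_single)
qed

lemma coeff_sum_monomials:
  assumes "finite A" "\<And>m. m \<in> A \<Longrightarrow> a m \<in> K" "\<And>m. m \<in> A \<Longrightarrow> keys m \<subseteq> X"
  shows "coeff (\<Sum>m\<in>A. a m * monomial m) m = (if m \<in> A then a m else 0)"
proof -
  have "coeff (\<Sum>m\<in>A. a m * monomial m) m = (\<Sum>m'\<in>A. if m' = m then a m else 0)"
    using rep_sum_monomials[of A a "\<lambda>m. m"] assms(2,3)
    by (auto simp: lookup_sum lookup_single when_def intro: sum.cong)
  then show ?thesis using assms(1) by simp
qed

lemma coeff_linear:
  assumes "\<And>i. i \<in> A \<Longrightarrow> a i \<in> K"
  shows "coeff (\<Sum>i\<in>A. a i * y i) m = (\<Sum>i\<in>A. a i * coeff (y i) m)"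
proof -
  have "lookup (Const a * P) m = a * lookup P m" for a and P :: "('a \<Rightarrow>\<^sub>0 nat) \<Rightarrow>\<^sub>0 'a"
    unfolding mult_map_scale_conv_mult[symmetric] by (simp add: Poly_Mapping.map.rep_eq when_def)
  then show ?thesis
    using assms by (simp add: ring_hom_sum[OF ring_hom_rep] ring_hom_mult[OF ring_hom_rep] rep_K lookup_sum)
qed

section \<open>The \<open>F\<close>-factorization of a polynomial ring\<close>

definition \<phi> :: "'a \<Rightarrow> 'a" where "\<phi> = extend (\<lambda>c. c ^ p) (\<lambda>x. x)"
definition \<sigma> :: "'a \<Rightarrow> 'a" where "\<sigma> = extend (\<lambda>c. c) (\<lambda>x. x ^ p)"

definition p_divisible :: "('a \<Rightarrow>\<^sub>0 nat) \<Rightarrow> bool" where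
  "p_divisible m \<longleftrightarrow> (\<forall>x. p dvd lookup m x)"

lemma ring_hom_\<phi>: "is_ring_hom \<phi>" and ring_hom_\<sigma>: "is_ring_hom \<sigma>"
  unfolding \<phi>_def \<sigma>_def by (intro ring_hom_extend ring_hom_power_p ring_hom_id)+

lemma \<phi>_K: "a \<in> K \<Longrightarrow> \<phi> a = a ^ p" and \<phi>_X: "x \<in> X \<Longrightarrow> \<phi> x = x"
  and \<sigma>_K: "a \<in> K \<Longrightarrow> \<sigma> a = a" and \<sigma>_X: "x \<in> X \<Longrightarrow> \<sigma> x = x ^ p"
  by (simp_all add: \<phi>_def \<sigma>_def extend_K extend_X ring_hom_power_p ring_hom_id)

lemma \<phi>\<sigma>: "\<phi> (\<sigma> x) = x ^ p"
proof -
  have "(\<lambda>x. \<phi> (\<sigma> x)) = (\<lambda>x. x ^ p)"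
    by (rule hom_eqI[OF ring_hom_comp[OF ring_hom_\<phi> ring_hom_\<sigma>] ring_hom_power_p])
       (simp_all add: \<phi>_K \<phi>_X \<sigma>_K \<sigma>_X ring_hom_power[OF ring_hom_\<phi>])
  then show ?thesis by (rule fun_cong)
qed

lemma \<sigma>\<phi>: "\<sigma> (\<phi> x) = x ^ p"
proof -
  have "(\<lambda>x. \<sigma> (\<phi> x)) = (\<lambda>x. x ^ p)"
    by (rule hom_eqI[OF ring_hom_comp[OF ring_hom_\<sigma> ring_hom_\<phi>] ring_hom_power_p])
       (simp_all add: \<phi>_K \<phi>_X \<sigma>_K \<sigma>_X ring_hom_power[OF ring_hom_\<sigma>])
  then show ?thesis by (rule fun_cong)
qed

lemma \<phi>_monomial: "keys m \<subseteq> X \<Longrightarrow> \<phi> (monomial m) = monomial m"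
  unfolding monom_value_hom[OF ring_hom_\<phi>] by (rule monom_value_cong) (auto simp: \<phi>_X)

lemma \<sigma>_monomial: "keys m \<subseteq> X \<Longrightarrow> \<sigma> (monomial m) = monomial m ^ p"
  unfolding monom_value_hom[OF ring_hom_\<sigma>] monom_value_hom[OF ring_hom_power_p]
  by (rule monom_value_cong) (auto simp: \<sigma>_X)

lemma \<phi>_sum:
  "(\<And>m. m \<in> A \<Longrightarrow> a m \<in> K) \<Longrightarrow> (\<And>m. m \<in> A \<Longrightarrow> keys m \<subseteq> X) \<Longrightarrow>
   \<phi> (\<Sum>m\<in>A. a m * monomial m) = (\<Sum>m\<in>A. a m ^ p * monomial m)"
  by (simp add: ring_hom_sum[OF ring_hom_\<phi>] ring_hom_mult[OF ring_hom_\<phi>] \<phi>_K \<phi>_monomial)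

lemma \<sigma>_sum:
  "(\<And>m. m \<in> A \<Longrightarrow> a m \<in> K) \<Longrightarrow> (\<And>m. m \<in> A \<Longrightarrow> keys m \<subseteq> X) \<Longrightarrow>
   \<sigma> (\<Sum>m\<in>A. a m * monomial m) = (\<Sum>m\<in>A. a m * monomial m ^ p)"
  by (simp add: ring_hom_sum[OF ring_hom_\<sigma>] ring_hom_mult[OF ring_hom_\<sigma>] \<sigma>_K \<sigma>_monomial)

lemma coeff_\<phi>: "coeff (\<phi> x) m = coeff x m ^ p"
proof -
  have "\<phi> x = (\<Sum>m\<in>keys (rep x). coeff x m ^ p * monomial m)"
    by (subst expansion, rule \<phi>_sum) (auto simp: coeff_K dest: coeff_keys)
  then have "coeff (\<phi> x) m = (if m \<in> keys (rep x) then coeff x m ^ p else 0)"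
    using coeff_sum_monomials[of "keys (rep x)" "\<lambda>m. coeff x m ^ p" m]
      coeff_K coeff_keys subring_power[OF subring_K] by simp
  then show ?thesis using p_pos by (simp add: in_keys_iff power_0_left)
qed

lemma monomial_root:
  assumes "p_divisible m"
  obtains m' where "keys m' = keys m" "monomial m = monomial m' ^ p"
proof -
  define m' where "m' = Poly_Mapping.map (\<lambda>k. k div p) m"
  have lookup: "lookup m x = p * lookup m' x" for x
    using assms by (simp add: m'_def p_divisible_def Poly_Mapping.map.rep_eq when_def)
  then have keys: "keys m' = keys m" using p_pos by (auto simp: in_keys_iff)
  have "monomial m = monomial m' ^ p"
    by (simp add: monom_value_def keys lookup prod_power_distrib mult.commute[of p] power_mult)
  then show ?thesis using that keys by blast
qed

lemma monomial_power_p: "\<exists>m'. keys m' = keys m \<and> p_divisible m' \<and> monomial m ^ p = monomial m'"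
proof -
  define m' where "m' = Poly_Mapping.map (\<lambda>k. p * k) m"
  have lookup: "lookup m' x = p * lookup m x" for x
    by (simp add: m'_def Poly_Mapping.map.rep_eq when_def)
  then have keys: "keys m' = keys m" using p_pos by (auto simp: in_keys_iff)
  have "monomial m ^ p = monomial m'"
    by (simp add: monom_value_def keys lookup prod_power_distrib mult.commute[of p] power_mult)
  then show ?thesis using keys lookup by (auto simp: p_divisible_def)
qed

text \<open>In coordinates, the image of \<open>\<phi>\<close> restricts only the coefficients and the image of \<open>\<sigma>\<close> only the
exponents. This separation is behind all conditions on \<open>\<phi>\<close> and \<open>\<sigma>\<close>.\<close>

lemma range_\<phi>_iff: "x \<in> range \<phi> \<longleftrightarrow> (\<forall>m. coeff x m \<in> (\<lambda>a. a ^ p) ` K)"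
proof
  assume "x \<in> range \<phi>"
  then show "\<forall>m. coeff x m \<in> (\<lambda>a. a ^ p) ` K" using coeff_\<phi> coeff_K by blast
next
  assume "\<forall>m. coeff x m \<in> (\<lambda>a. a ^ p) ` K"
  then have "\<forall>m. \<exists>a. a \<in> K \<and> coeff x m = a ^ p" by blast
  from choice[OF this] obtain a where a: "\<And>m. a m \<in> K" "\<And>m. coeff x m = a m ^ p" by blast
  have "x = (\<Sum>m\<in>keys (rep x). a m ^ p * monomial m)" using expansion[of x] by (simp add: a(2))
  also have "\<dots> = \<phi> (\<Sum>m\<in>keys (rep x). a m * monomial m)"
    by (rule \<phi>_sum[symmetric]) (auto simp: a(1) dest: coeff_keys)
  finally show "x \<in> range \<phi>" by blast
qed

lemma range_\<sigma>_iff: "x \<in> range \<sigma> \<longleftrightarrow> (\<forall>m\<in>keys (rep x). p_divisible m)"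
proof
  assume "x \<in> range \<sigma>"
  then obtain y where y: "x = \<sigma> y" by blast
  have "\<forall>m. \<exists>m'. keys m' = keys m \<and> p_divisible m' \<and> monomial m ^ p = monomial m'"
    using monomial_power_p by blast
  from choice[OF this] obtain s where s: "\<And>m. keys (s m) = keys m" "\<And>m. p_divisible (s m)"
    "\<And>m. monomial m ^ p = monomial (s m)" by blast
  have "x = (\<Sum>m\<in>keys (rep y). coeff y m * monomial (s m))"
    unfolding y by (subst (1) expansion, subst \<sigma>_sum) (auto simp: coeff_K s dest: coeff_keys)
  then have "rep x = (\<Sum>m\<in>keys (rep y). single (s m) (coeff y m))"
    using rep_sum_monomials[of "keys (rep y)" "coeff y" s] coeff_K coeff_keys s(1) by simp
  then have "keys (rep x) \<subseteq> s ` keys (rep y)"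
    using keys_sum[of "\<lambda>m. single (s m) (coeff y m)" "keys (rep y)"] by (auto split: if_splits)
  then show "\<forall>m\<in>keys (rep x). p_divisible m" using s(2) by blast
next
  assume div: "\<forall>m\<in>keys (rep x). p_divisible m"
  have "\<forall>m\<in>keys (rep x). \<exists>m'. keys m' = keys m \<and> monomial m = monomial m' ^ p"
    using div monomial_root by metis
  from bchoice[OF this] obtain r where r: "\<And>m. m \<in> keys (rep x) \<Longrightarrow> keys (r m) = keys m"
    "\<And>m. m \<in> keys (rep x) \<Longrightarrow> monomial m = monomial (r m) ^ p" by blast
  have "x = (\<Sum>m\<in>keys (rep x). coeff x m * monomial m)" by (rule expansion)
  also have "\<dots> = (\<Sum>m\<in>keys (rep x). \<sigma> (coeff x m * monomial (r m)))"
    using r coeff_keys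
    by (intro sum.cong refl) (simp add: ring_hom_mult[OF ring_hom_\<sigma>] \<sigma>_K coeff_K \<sigma>_monomial)
  also have "\<dots> = \<sigma> (\<Sum>m\<in>keys (rep x). coeff x m * monomial (r m))"
    by (rule ring_hom_sum[OF ring_hom_\<sigma>, symmetric])
  finally show "x \<in> range \<sigma>" by blast
qed

lemma range_power_p: "range (\<lambda>x. x ^ p) = range \<phi> \<inter> range \<sigma>"
proof (intro equalityI subsetI)
  fix x assume "x \<in> range (\<lambda>x::'a. x ^ p)"
  then obtain z where "x = z ^ p" by blast
  then have "x = \<phi> (\<sigma> z)" "x = \<sigma> (\<phi> z)" by (simp_all add: \<phi>\<sigma> \<sigma>\<phi>)
  then show "x \<in> range \<phi> \<inter> range \<sigma>" by blast
next
  fix x assume x: "x \<in> range \<phi> \<inter> range \<sigma>"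
  then obtain y where y: "x = \<phi> y" by blast
  have "m \<in> keys (rep x)" if "m \<in> keys (rep y)" for m
    using that K_power_eq_0[OF coeff_K] by (auto simp: y coeff_\<phi> in_keys_iff)
  then have "y \<in> range \<sigma>" using x by (auto simp: range_\<sigma>_iff)
  then show "x \<in> range (\<lambda>x. x ^ p)" using y \<phi>\<sigma> by auto
qed

lemma lin_span_coeff:
  assumes es: "set es \<subseteq> K" and x: "x \<in> lin_span es (range \<phi>)"
  shows "coeff x m \<in> lin_span es ((\<lambda>a. a ^ p) ` K)"
proof -
  obtain y where y: "x = (\<Sum>j<length es. es ! j * y j)" "\<And>j. j < length es \<Longrightarrow> y j \<in> range \<phi>"
    using x by (auto simp: lin_span_def)
  have "coeff x m = (\<Sum>j<length es. es ! j * coeff (y j) m)"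
    unfolding y(1) by (rule coeff_linear) (use es in \<open>auto dest: nth_mem\<close>)
  moreover have "coeff (y j) m \<in> (\<lambda>a. a ^ p) ` K" if "j < length es" for j
    using y(2)[OF that] by (simp add: range_\<phi>_iff)
  ultimately show ?thesis
    unfolding lin_span_def by (intro CollectI exI[of _ "\<lambda>j. coeff (y j) m"]) simp
qed

text \<open>The control on the supports makes the \<open>y\<^sub>j\<close> lie in the image of \<open>\<sigma>\<close> as soon as \<open>x\<close> does, which is
what the last condition on an \<open>F\<close>-factorization needs.\<close>

lemma lin_span_of_coeff:
  assumes es: "set es \<subseteq> K"
    and x: "\<And>m. m \<in> keys (rep x) \<Longrightarrow> coeff x m \<in> lin_span es ((\<lambda>a. a ^ p) ` K)"
  obtains y where "x = (\<Sum>j<length es. es ! j * y j)" "\<And>j. j < length es \<Longrightarrow> y j \<in> range \<phi>"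
    "\<And>j. j < length es \<Longrightarrow> keys (rep (y j)) \<subseteq> keys (rep x)"
proof -
  have "\<forall>m\<in>keys (rep x). \<exists>a. coeff x m = (\<Sum>j<length es. es ! j * a j) \<and>
      (\<forall>j<length es. a j \<in> (\<lambda>a. a ^ p) ` K)"
    using x by (simp add: lin_span_def)
  from bchoice[OF this] obtain a where
    a: "\<And>m j. m \<in> keys (rep x) \<Longrightarrow> j < length es \<Longrightarrow> a m j \<in> (\<lambda>a. a ^ p) ` K"
    and sum: "\<And>m. m \<in> keys (rep x) \<Longrightarrow> coeff x m = (\<Sum>j<length es. es ! j * a m j)" by blast
  define y where "y j = (\<Sum>m\<in>keys (rep x). a m j * monomial m)" for j
  have aK: "a m j \<in> K" if "m \<in> keys (rep x)" "j < length es" for m j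
    using a[OF that] subring_power[OF subring_K] by auto
  have coeff_y: "coeff (y j) m = (if m \<in> keys (rep x) then a m j else 0)" if "j < length es" for j m
    unfolding y_def by (rule coeff_sum_monomials) (use that aK coeff_keys in auto)
  have "0 \<in> (\<lambda>a. a ^ p) ` K" using p_pos by (intro image_eqI[of _ _ 0] zero_mem) (simp add: power_0_left)
  then have "y j \<in> range \<phi>" if "j < length es" for j
    using coeff_y[OF that] a that by (auto simp: range_\<phi>_iff)
  moreover have "keys (rep (y j)) \<subseteq> keys (rep x)" if "j < length es" for j
    using coeff_y[OF that] by (auto simp: in_keys_iff split: if_splits)
  moreover have "x = (\<Sum>j<length es. es ! j * y j)"
  proof -
    have "x = (\<Sum>m\<in>keys (rep x). (\<Sum>j<length es. es ! j * a m j) * monomial m)"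
      by (subst expansion, rule sum.cong) (auto simp: sum)
    also have "\<dots> = (\<Sum>j<length es. es ! j * y j)"
      unfolding y_def sum_distrib_left sum_distrib_right
      by (subst sum.swap) (simp add: mult.assoc)
    finally show ?thesis .
  qed
  ultimately show ?thesis using that by blast
qed

lemma F_factorization_\<phi>_\<sigma>: "F_factorization p G \<phi> \<sigma>"
  unfolding F_factorization_def
proof (intro conjI ballI allI impI)
  show "inj \<phi>"
  proof (rule injI)
    fix x y assume "\<phi> x = \<phi> y"
    then have "coeff (x - y) m ^ p = 0" for m
      using coeff_\<phi>[of "x - y" m]
      by (simp add: ring_hom_diff[OF ring_hom_\<phi>] ring_hom_0[OF ring_hom_rep])
    then have "coeff (x - y) m = 0" for m by (rule K_power_eq_0[OF coeff_K])
    then have "rep (x - y) = 0" by (intro poly_mapping_eqI) simp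
    then have "x - y = poly_value 0" using poly_value_rep[of "x - y"] by simp
    then show "x = y" by (simp add: ring_hom_0[OF ring_hom_poly_value])
  qed
  show "\<phi> ` G n \<subseteq> G n" for n
    unfolding \<phi>_def using subring_power[OF subring_K] X_mem
    by (auto intro!: extend_graded[OF graded_G])
  show "\<phi> \<circ> \<sigma> = \<sigma> \<circ> \<phi>" "\<phi> \<circ> \<sigma> = (\<lambda>x. x ^ p)" by (simp_all add: fun_eq_iff \<phi>\<sigma> \<sigma>\<phi>)
  fix es :: "'a list" assume es: "set es \<subseteq> K"
  show "range \<sigma> \<inter> lin_span es (range \<phi>) = lin_span es (range (\<lambda>x. x ^ p))"
  proof (intro equalityI subsetI)
    fix x assume x: "x \<in> range \<sigma> \<inter> lin_span es (range \<phi>)"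
    obtain y where y: "x = (\<Sum>j<length es. es ! j * y j)" "\<And>j. j < length es \<Longrightarrow> y j \<in> range \<phi>"
      "\<And>j. j < length es \<Longrightarrow> keys (rep (y j)) \<subseteq> keys (rep x)"
      using lin_span_of_coeff[OF es lin_span_coeff[OF es]] x by blast
    have "y j \<in> range \<sigma>" if "j < length es" for j
      using y(3)[OF that] x by (auto simp: range_\<sigma>_iff)
    then show "x \<in> lin_span es (range (\<lambda>x. x ^ p))"
      unfolding lin_span_def range_power_p using y(1,2) by (intro CollectI exI[of _ y]) simp
  next
    fix x assume "x \<in> lin_span es (range (\<lambda>x. x ^ p))"
    then obtain y where y: "x = (\<Sum>j<length es. es ! j * y j)"
      "\<And>j. j < length es \<Longrightarrow> y j \<in> range \<phi> \<inter> range \<sigma>"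
      unfolding lin_span_def range_power_p by auto
    have "x \<in> lin_span es (range \<phi>)"
      unfolding lin_span_def using y by (intro CollectI exI[of _ y]) auto
    moreover have "is_subring (range \<sigma>)"
      unfolding is_subring_def
      by (auto simp flip: ring_hom_diff[OF ring_hom_\<sigma>] ring_hom_mult[OF ring_hom_\<sigma>])
         (metis ring_hom_1[OF ring_hom_\<sigma>] rangeI)
    then have "x \<in> range \<sigma>"
      unfolding y(1)
    proof (rule subring_sum, rule_tac subringD(6))
      fix j assume j: "j \<in> {..<length es}"
      then show "y j \<in> range \<sigma>" using y(2) by blast
      have "es ! j \<in> K" using es j by auto
      then show "es ! j \<in> range \<sigma>" using \<sigma>_K by (metis rangeI)
    qed
    ultimately show "x \<in> range \<sigma> \<inter> lin_span es (range \<phi>)" by blast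
  qed
qed (simp_all add: ring_hom_\<phi> ring_hom_\<sigma> \<phi>_K \<sigma>_K)

section \<open>The divided power derivatives\<close>

text \<open>\<open>taylor y\<close> substitutes \<open>y + T\<close> for the variable \<open>y\<close>; its coefficients are the divided power
derivatives \<open>(1/n!) \<partial>\<^sup>n/\<partial>y\<^sup>n\<close>, defined without division.\<close>

definition shift_var :: "'a \<Rightarrow> 'a \<Rightarrow> 'a fps" where
  "shift_var y x = fps_const x + (if x = y then fps_X else 0)"

definition taylor :: "'a \<Rightarrow> 'a \<Rightarrow> 'a fps" where
  "taylor y = extend fps_const (shift_var y)"

definition hasse_diff :: "'a \<Rightarrow> nat \<Rightarrow> 'a \<Rightarrow> 'a" where
  "hasse_diff y n x = fps_nth (taylor y x) n"

lemma ring_hom_taylor: "is_ring_hom (taylor y)"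
  unfolding taylor_def by (rule ring_hom_extend[OF ring_hom_fps_const])

lemma taylor_nth_0_1:
  "fps_nth (taylor y x) 0 = x \<and> fps_nth (taylor y x) 1 = poly_value (pdiff y (rep x))"
proof -
  let ?t = "subst fps_const (shift_var y)"
  have t: "is_ring_hom ?t" by (rule ring_hom_subst[OF ring_hom_fps_const])
  have *: "rep x \<in> polys_over UNIV X" using rep_polys[of x] by (auto simp: polys_over_def)
  have "fps_nth (?t P) 0 = poly_value P \<and> fps_nth (?t P) 1 = poly_value (pdiff y P)"
    if "P \<in> polys_over UNIV X" for P
    using that
  proof (induction P rule: poly_induct)
    case (Const c)
    then show ?case
      by (simp add: subst_Const[OF ring_hom_fps_const] poly_value_single ring_hom_0[OF ring_hom_poly_value])
  next
    case (Var x)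
    then show ?case
      by (simp add: subst_Var[OF ring_hom_fps_const] shift_var_def poly_value_single pdiff_Var
          ring_hom_0[OF ring_hom_poly_value] ring_hom_1[OF ring_hom_poly_value]
          del: One_nat_def)
  next
    case (add P Q)
    then show ?case
      by (simp add: ring_hom_add[OF t] ring_hom_add[OF ring_hom_poly_value] pdiff_add)
  next
    case (mult P Q)
    then show ?case
      by (simp add: ring_hom_mult[OF t] ring_hom_mult[OF ring_hom_poly_value]
          ring_hom_add[OF ring_hom_poly_value] pdiff_mult fps_mult_nth add.commute)
  qed
  from this[OF *] show ?thesis by (simp add: taylor_def extend_def poly_value_rep)
qed

lemma hasse_derivation_hasse_diff: "hasse_derivation (hasse_diff y)"
  unfolding hasse_diff_def
  by (rule hasse_derivation_of_series[OF ring_hom_taylor]) (simp add: taylor_nth_0_1)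

lemma rep_hasse_diff_1:
  assumes "y \<in> X"
  shows "rep (hasse_diff y 1 x) = pdiff y (rep x)"
proof -
  have "lookup (pdiff y (rep x)) m \<in> K" for m
    unfolding lookup_pdiff
    by (intro subringD(6)[OF subring_K] subring_of_nat[OF subring_K] coeff_K)
  moreover have "keys m \<subseteq> X" if "m \<in> keys (pdiff y (rep x))" for m
  proof -
    have "m + single y 1 \<in> keys (rep x)" using that by (auto simp: in_keys_iff lookup_pdiff)
    then have "keys (m + single y 1) \<subseteq> X" by (rule coeff_keys)
    moreover have "keys m \<subseteq> keys (m + single y 1)" by (auto simp: in_keys_iff lookup_add)
    ultimately show ?thesis by blast
  qed
  ultimately have "pdiff y (rep x) \<in> polys_over K X" by (simp add: polys_over_def)
  then show ?thesis using taylor_nth_0_1[of y x] by (simp add: hasse_diff_def rep_poly_value)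
qed

lemma hasse_homogeneous_hasse_diff:
  assumes "y \<in> X"
  shows "hasse_homogeneous G (- int (w y)) (hasse_diff y)"
  unfolding hasse_homogeneous_def Let_def
proof (intro allI ballI)
  fix k n x assume x: "x \<in> G k"
  let ?H = "hom_series (w y) G"
  have H: "graded_family ?H" by (rule graded_family_hom_series[OF graded_G])
  have "shift_var y z \<in> ?H (w z)" if "z \<in> X" for z
    using graded_familyD(2,3)[OF H] fps_const_hom_series[OF graded_G X_mem[OF that]]
      fps_X_hom_series[OF graded_G, of "w y"] by (auto simp: shift_var_def)
  then have "taylor y x \<in> ?H k"
    unfolding taylor_def using x by (intro extend_graded[OF H]) (auto intro: fps_const_hom_series[OF graded_G])
  then have mem: "n * w y \<le> k \<Longrightarrow> hasse_diff y n x \<in> G (k - n * w y)"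
    "k < n * w y \<Longrightarrow> hasse_diff y n x = 0"
    by (auto simp: hom_series_iff hasse_diff_def)
  have e: "int k + int n * - int (w y) = int k - int (n * w y)" by simp
  show "if int k + int n * - int (w y) < 0 then hasse_diff y n x = 0
      else hasse_diff y n x \<in> G (nat (int k + int n * - int (w y)))"
    unfolding e using mem by (cases "n * w y \<le> k") (simp_all add: nat_diff_distrib del: of_nat_mult)
qed

lemma hasse_diff_\<phi>: "y \<in> X \<Longrightarrow> hasse_diff y n (\<phi> x) = \<phi> (hasse_diff y n x)"
proof -
  assume y: "y \<in> X"
  have "(\<lambda>x. taylor y (\<phi> x)) = (\<lambda>x. map_fps \<phi> (taylor y x))"
  proof (rule hom_eqI[OF ring_hom_comp[OF ring_hom_taylor ring_hom_\<phi>]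
      ring_hom_comp[OF ring_hom_map_fps[OF ring_hom_\<phi>] ring_hom_taylor]])
    fix a assume a: "a \<in> K"
    then have "a ^ p \<in> K" by (rule subring_power[OF subring_K])
    then show "taylor y (\<phi> a) = map_fps \<phi> (taylor y a)"
      using a by (simp add: \<phi>_K taylor_def extend_K ring_hom_fps_const fps_eq_iff ring_hom_0[OF ring_hom_\<phi>])
  next
    fix x assume "x \<in> X"
    then show "taylor y (\<phi> x) = map_fps \<phi> (taylor y x)"
      by (auto simp: \<phi>_X taylor_def extend_X ring_hom_fps_const shift_var_def fps_eq_iff fps_X_def
          ring_hom_0[OF ring_hom_\<phi>] ring_hom_1[OF ring_hom_\<phi>])
  qed
  then have "taylor y (\<phi> x) = map_fps \<phi> (taylor y x)" by (rule fun_cong)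
  then show ?thesis by (simp add: hasse_diff_def)
qed

text \<open>Elements of the prime field are their own \<open>p\<close>-th powers, so the exponent can be cancelled.\<close>

lemma coeff_in_lin_span:
  assumes es: "set es \<subseteq> K" and y: "y \<in> X" "\<not> p dvd lookup m y"
    and d: "hasse_diff y 1 x \<in> lin_span es (range \<phi>)"
  shows "coeff x m \<in> lin_span es ((\<lambda>a. a ^ p) ` K)"
proof -
  let ?a = "of_nat (lookup m y) :: 'a"
  have pos: "lookup m y > 0" using y(2) by (metis dvd_0_right gr0I)
  have eq: "m - single y 1 + single y 1 = m"
    using pos by (intro poly_mapping_eqI) (auto simp: lookup_add lookup_minus lookup_single when_def)
  have "coeff (hasse_diff y 1 x) (m - single y 1) = ?a * coeff x m"
    unfolding rep_hasse_diff_1[OF y(1)] lookup_pdiff eq using pos by (simp add: lookup_minus)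
  then have "?a * coeff x m \<in> lin_span es ((\<lambda>a. a ^ p) ` K)"
    using lin_span_coeff[OF es d] by metis
  then obtain z where z: "?a * coeff x m = (\<Sum>j<length es. es ! j * z j)"
    "\<And>j. j < length es \<Longrightarrow> z j \<in> (\<lambda>a. a ^ p) ` K"
    by (auto simp: lin_span_def)
  have "?a \<noteq> 0" using y(2) of_nat_eq_0_iff_char_dvd[where 'a = 'a] char_p by auto
  then obtain b where b: "b \<in> K" "?a * b = 1"
    using K_inverse[OF subring_of_nat[OF subring_K]] by blast
  have "(of_nat k :: 'a) ^ p = of_nat k" for k
    by (induction k) (use p_pos in \<open>simp_all add: power_p_add power_0_left\<close>)
  then have "?a * b ^ p = (?a * b) ^ p" by (simp add: power_mult_distrib)
  then have "(b ^ p * ?a) * coeff x m = coeff x m" using b(2) by (simp add: mult.commute)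
  then have "b ^ p * (?a * coeff x m) = coeff x m" by (simp only: mult.assoc)
  then have "coeff x m = (\<Sum>j<length es. es ! j * (b ^ p * z j))"
    unfolding z(1) by (simp add: sum_distrib_left mult.left_commute[of _ "b ^ p"])
  moreover have "b ^ p * z j \<in> (\<lambda>a. a ^ p) ` K" if j: "j < length es" for j
  proof -
    obtain c where "c \<in> K" "z j = c ^ p" using z(2)[OF j] by blast
    then have "b * c \<in> K" "b ^ p * z j = (b * c) ^ p"
      using scale_mem[OF b(1)] by (simp_all add: power_mult_distrib)
    then show ?thesis by blast
  qed
  ultimately show ?thesis
    unfolding lin_span_def by (intro CollectI exI[of _ "\<lambda>j. b ^ p * z j"]) simp
qed

text \<open>If all first derivatives of \<open>x\<close> lie in the span of the \<open>\<epsilon>\<^sub>j im(\<phi>)\<close>, split the monomials of \<open>x\<close>: those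
with all exponents divisible by \<open>p\<close> form an element of the image of \<open>\<sigma>\<close>, and the coefficient of any
other monomial can be recovered from a first derivative.\<close>

lemma admissible_hasse_diff: "admissible p G \<phi> \<sigma> (hasse_diff ` X)"
  unfolding admissible_def
proof (intro conjI ballI allI impI)
  fix \<delta> assume "\<delta> \<in> hasse_diff ` X"
  then obtain y where y: "y \<in> X" "\<delta> = hasse_diff y" by blast
  show "hasse_derivation \<delta>" unfolding y(2) by (rule hasse_derivation_hasse_diff)
  show "\<exists>d<0. hasse_homogeneous G d \<delta>"
    using hasse_homogeneous_hasse_diff[OF y(1)] w_pos[OF y(1)] y(2)
    by (intro exI[of _ "- int (w y)"]) simp
  show "\<delta> n \<circ> \<phi> = \<phi> \<circ> \<delta> n" for n using hasse_diff_\<phi>[OF y(1)] by (simp add: fun_eq_iff y(2))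
next
  fix x es assume es: "set es \<subseteq> K"
    and d: "\<forall>\<delta>\<in>hasse_diff ` X. hasse_bracket p \<delta> 0 x \<in> lin_span es (range \<phi>)"
  let ?A = "{m\<in>keys (rep x). p_divisible m}" and ?B = "{m\<in>keys (rep x). \<not> p_divisible m}"
  define a where "a = (\<Sum>m\<in>?A. coeff x m * monomial m)"
  define b where "b = (\<Sum>m\<in>?B. coeff x m * monomial m)"
  have coeff_a: "coeff a m = (if m \<in> ?A then coeff x m else 0)" for m
    unfolding a_def by (rule coeff_sum_monomials) (auto simp: coeff_K dest: coeff_keys)
  have coeff_b: "coeff b m = (if m \<in> ?B then coeff x m else 0)" for m
    unfolding b_def by (rule coeff_sum_monomials) (auto simp: coeff_K dest: coeff_keys)
  have "keys (rep x) = ?A \<union> ?B" by blast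
  then have "x = (\<Sum>m\<in>?A \<union> ?B. coeff x m * monomial m)" using expansion[of x] by simp
  also have "\<dots> = a + b" unfolding a_def b_def by (rule sum.union_disjoint) auto
  finally have x: "x = a + b" .
  have "a \<in> range \<sigma>" using coeff_a by (auto simp: range_\<sigma>_iff in_keys_iff split: if_splits)
  moreover have "coeff b m \<in> lin_span es ((\<lambda>a. a ^ p) ` K)" if "m \<in> keys (rep b)" for m
  proof -
    have m: "m \<in> ?B" using that coeff_b by (auto simp: in_keys_iff split: if_splits)
    then obtain y where y: "\<not> p dvd lookup m y" by (auto simp: p_divisible_def)
    then have "y \<in> keys m" by (metis dvd_0_right in_keys_iff)
    then have "y \<in> X" using m coeff_keys by blast
    then have "hasse_diff y 1 x \<in> lin_span es (range \<phi>)" using d by (auto simp: hasse_bracket_def)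
    from coeff_in_lin_span[OF es \<open>y \<in> X\<close> y this] show ?thesis using coeff_b m by simp
  qed
  then have "b \<in> lin_span es (range \<phi>)"
  proof -
    assume "\<And>m. m \<in> keys (rep b) \<Longrightarrow> coeff b m \<in> lin_span es ((\<lambda>a. a ^ p) ` K)"
    from lin_span_of_coeff[OF es this] obtain y where
      "b = (\<Sum>j<length es. es ! j * y j)" "\<And>j. j < length es \<Longrightarrow> y j \<in> range \<phi>" by blast
    then show ?thesis unfolding lin_span_def by (intro CollectI exI[of _ y]) simp
  qed
  ultimately show "x \<in> {a + b |a b. a \<in> range \<sigma> \<and> b \<in> lin_span es (range \<phi>)}" using x by blast
qed

end

section \<open>The criterion\<close>

theorem theorem5p1:
  fixes G :: "nat \<Rightarrow> 'a::comm_ring_1 set" and p :: nat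
  assumes "graded_ring G"
    and "is_subfield (G 0)"
    and "prime p"
    and "CHAR('a) = p"
  shows "is_polynomial_ring G \<longleftrightarrow>
    (\<exists>\<phi> \<sigma> \<D>. F_factorization p G \<phi> \<sigma> \<and> admissible p G \<phi> \<sigma> \<D>)"
proof
  interpret graded_char_p G p
    using assms by (simp add: graded_char_p_def graded_char_p_axioms_def)
  assume "is_polynomial_ring G"
  then obtain X where X: "\<forall>x\<in>X. \<exists>n. n > 0 \<and> x \<in> G n" "algebraically_independent K X"
    "generates_algebra K X"
    by (auto simp: is_polynomial_ring_def)
  from bchoice[OF X(1)] obtain w where w: "\<And>x. x \<in> X \<Longrightarrow> w x > 0" "\<And>x. x \<in> X \<Longrightarrow> x \<in> G (w x)"
    by blast
  interpret graded_polynomial_ring G p X w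
    by unfold_locales (use w X in auto)
  show "\<exists>\<phi> \<sigma> \<D>. F_factorization p G \<phi> \<sigma> \<and> admissible p G \<phi> \<sigma> \<D>"
    using F_factorization_\<phi>_\<sigma> admissible_hasse_diff by blast
next
  assume "\<exists>\<phi> \<sigma> \<D>. F_factorization p G \<phi> \<sigma> \<and> admissible p G \<phi> \<sigma> \<D>"
  then obtain \<phi> \<sigma> \<D> where "F_factorization p G \<phi> \<sigma>" "admissible p G \<phi> \<sigma> \<D>" by blast
  then interpret F_data G p \<phi> \<sigma> \<D>
    using assms by (simp add: F_data_def F_data_axioms_def graded_char_p_def graded_char_p_axioms_def)
  show "is_polynomial_ring G" by (rule is_polynomial_ring)
qed

end
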